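(* Let $\mathbf X_n(\mathbf x)$ be the process $\mathbf X_{n+1}=\mathbf A_{n+1}\mathbf X_n+\mathbf B_{n+1}$ on $\mathbb R^d$ started at $\mathbf x$, driven by i.i.d. copies $(\mathbf A_n,\mathbf B_n)_{n\ge 1}$ of $(\mathbf A,\mathbf B)$. Assume: (a) $\gamma_L<0$; (b) $\mathbb E\|\mathbf A\|^s<\infty$ for some $s>0$; (c) $\mathbb E\log^+|\mathbf B|<\infty$; (d) $\mathbb P(\mathbf A\mathbf x+\mathbf B=\mathbf x)<1$ for every $\mathbf x\in\mathbb R^d$; (e) there is $s_1>0$ with $h_{\mathbf A}(s_1)>1$, and there is $\alpha\in(0,\alpha_\infty)$ with $h_{\mathbf A}(\alpha)=1$; (f) the support of the stationary distribution $\nu_\infty$ is unbounded; (g) there are $R_0,z_0>1$, $C_0>0$ and $\alpha_+\in(\alpha,\alpha_\infty]$ such that $\mathbb P(|\mathbf A\mathbf x+\mathbf B|>zR)\le \frac{C_0}{z^{\alpha_+}}\,\mathbb P(|\mathbf A\mathbf x+\mathbf B|>R)$ for all $R\ge R_0$, $z\ge z_0$ and $\mathbf x$ with $|\mathbf x|\le R$; (h) there is $n_0\ge 1$ such that $\mathbb P(\mathbf x\cdot\Pi_{n_0}\mathbf y=0)<1$ for all $\mathbf x,\mathbf y\in\mathbb R^d\setminus\{\mathbf 0\}$. Then for all $\mathbf x_0\in\mathbb R^d$, $$\lim_{R\to\infty}\frac{\log\mathbb E[\tau_R(\mathbf x_0)]}{\log R}=\alpha .$$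
   Context: Let $d\ge1$, let $\mathbf A$ be a random real $d\times d$ matrix and $\mathbf B$ a random vector in $\mathbb R^d$ (possibly dependent), and let $(\mathbf A_n,\mathbf B_n)_{n\ge1}$ be i.i.d. copies of the pair $(\mathbf A,\mathbf B)$. For $\mathbf x\in\mathbb R^d$: $\mathbf X_0(\mathbf x)=\mathbf x$, $\mathbf X_{n+1}(\mathbf x)=\mathbf A_{n+1}\mathbf X_n(\mathbf x)+\mathbf B_{n+1}$. $|\cdot|$ is the Euclidean norm, $\|\mathbf M\|=\sup_{|\mathbf x|=1}|\mathbf M\mathbf x|$, $\log^+x=\log(x\vee1)$. $\Pi_n=\mathbf A_n\mathbf A_{n-1}\cdots\mathbf A_1$. The Lyapunov exponent is $\gamma_L=\lim_{n}\frac1n\mathbb E\log\|\Pi_n\|$ (which is also the a.s. limit of $\frac1n\log\|\Pi_n\|$). $h_{\mathbf A}(s)=\lim_n(\mathbb E\|\Pi_n\|^s)^{1/n}\in[0,\infty]$ for $s\ge0$. $\alpha_\infty=\sup\{s:\mathbb E\|\mathbf A\|^s<\infty\}$. Under (a)-(d) the process has a unique stationary distribution, denoted $\nu_\infty$. The exit time is $\tau_R(\mathbf x)=\inf\{n\ge0:|\mathbf X_n(\mathbf x)|>R\}$ with $\inf\emptyset=\infty$. *)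

theory Defs
  imports "HOL-Probability.Probability"
begin

section \<open>Extended-real arithmetic\<close>

text \<open>Logarithm on \<open>[0,\<infinity>]\<close>, with \<open>log 0 = -\<infinity>\<close> and \<open>log \<infinity> = \<infinity>\<close>; the library's \<^const>\<open>ln\<close> has \<open>ln 0 = 0\<close>.\<close>

definition log_ext :: "ennreal \<Rightarrow> ereal" where
  "log_ext x = (if x = 0 then -\<infinity> else if x = \<infinity> then \<infinity> else ereal (ln (enn2real x)))"

definition root_ext :: "nat \<Rightarrow> ennreal \<Rightarrow> ennreal" where
  "root_ext n x = (if x = \<infinity> then \<infinity> else ennreal (root n (enn2real x)))"

text \<open>Power with a possibly infinite exponent; only used for a base \<open>z > 1\<close>, where \<open>z\<^sup>\<infinity> = \<infinity>\<close>.\<close>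

definition powr_ext :: "real \<Rightarrow> ereal \<Rightarrow> ereal" where
  "powr_ext z a = (if a = \<infinity> then \<infinity> else if a = -\<infinity> then 0 else ereal (z powr real_of_ereal a))"

text \<open>Expectation of a random variable with values in \<open>[-\<infinity>,\<infinity>]\<close>, as \<open>E X\<^sup>+ - E X\<^sup>-\<close> (the
  conversion \<^const>\<open>e2ennreal\<close> sends negative values to \<open>0\<close>). It is meaningful when one of the two
  parts is finite; otherwise it evaluates to \<open>\<infinity> - \<infinity> = \<infinity>\<close>.\<close>

definition expectation_ext :: "'w measure \<Rightarrow> ('w \<Rightarrow> ereal) \<Rightarrow> ereal" where
  "expectation_ext M X =
     enn2ereal (\<integral>\<^sup>+\<omega>. e2ennreal (X \<omega>) \<partial>M) - enn2ereal (\<integral>\<^sup>+\<omega>. e2ennreal (- X \<omega>) \<partial>M)"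

section \<open>The driving sequence and the process\<close>

definition iid_copies ::
  "'w measure \<Rightarrow> ('w \<Rightarrow> real^'d^'d) \<Rightarrow> ('w \<Rightarrow> real^'d) \<Rightarrow>
   (nat \<Rightarrow> 'w \<Rightarrow> real^'d^'d) \<Rightarrow> (nat \<Rightarrow> 'w \<Rightarrow> real^'d) \<Rightarrow> bool" where
  "iid_copies M A B As Bs \<longleftrightarrow>
     prob_space.indep_vars M (\<lambda>_. borel) (\<lambda>n \<omega>. (As n \<omega>, Bs n \<omega>)) {1..} \<and>
     (\<forall>n\<ge>1. distr M borel (\<lambda>\<omega>. (As n \<omega>, Bs n \<omega>)) = distr M borel (\<lambda>\<omega>. (A \<omega>, B \<omega>)))"

primrec affine_process ::
  "(nat \<Rightarrow> 'w \<Rightarrow> real^'d^'d) \<Rightarrow> (nat \<Rightarrow> 'w \<Rightarrow> real^'d) \<Rightarrow> real^'d \<Rightarrow> nat \<Rightarrow> 'w \<Rightarrow> real^'d" where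
  "affine_process As Bs x 0 \<omega> = x"
| "affine_process As Bs x (Suc n) \<omega> = As (Suc n) \<omega> *v affine_process As Bs x n \<omega> + Bs (Suc n) \<omega>"

primrec mat_prod :: "(nat \<Rightarrow> 'w \<Rightarrow> real^'d^'d) \<Rightarrow> nat \<Rightarrow> 'w \<Rightarrow> real^'d^'d" where
  "mat_prod As 0 \<omega> = mat 1"
| "mat_prod As (Suc n) \<omega> = As (Suc n) \<omega> ** mat_prod As n \<omega>"

text \<open>The operator norm; \<^const>\<open>norm\<close> on the matrix type is the Frobenius norm.\<close>

abbreviation opnorm :: "real^'d^'d \<Rightarrow> real" where
  "opnorm Q \<equiv> onorm (\<lambda>x. Q *v x)"

text \<open>\<open>E \<parallel>Q\<parallel>\<^sup>s\<close> in \<open>[0,\<infinity>]\<close>. For \<open>s = 0\<close> the library has \<open>0 powr 0 = 0\<close>, which affects neither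
  \<open>moment_index\<close> below nor the values of \<open>h_moment\<close> at positive arguments.\<close>

definition norm_moment :: "'w measure \<Rightarrow> ('w \<Rightarrow> real^'d^'d) \<Rightarrow> real \<Rightarrow> ennreal" where
  "norm_moment M Q s = (\<integral>\<^sup>+\<omega>. ennreal (opnorm (Q \<omega>) powr s) \<partial>M)"

definition lyapunov_exponent :: "'w measure \<Rightarrow> (nat \<Rightarrow> 'w \<Rightarrow> real^'d^'d) \<Rightarrow> ereal" where
  "lyapunov_exponent M As =
     lim (\<lambda>n. expectation_ext M (\<lambda>\<omega>. log_ext (ennreal (opnorm (mat_prod As n \<omega>)))) / ereal (real n))"

definition h_moment :: "'w measure \<Rightarrow> (nat \<Rightarrow> 'w \<Rightarrow> real^'d^'d) \<Rightarrow> real \<Rightarrow> ennreal" where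
  "h_moment M As s = lim (\<lambda>n. root_ext n (norm_moment M (mat_prod As n) s))"

definition moment_index :: "'w measure \<Rightarrow> ('w \<Rightarrow> real^'d^'d) \<Rightarrow> ereal" where
  "moment_index M A = Sup (ereal ` {s. 0 \<le> s \<and> norm_moment M A s < \<infinity>})"

text \<open>\<open>\<nu>\<close> is the law of \<open>A X + B\<close> whenever \<open>X\<close> has law \<open>\<nu>\<close> and is independent of \<open>(A, B)\<close>.\<close>

definition stationary_distribution ::
  "'w measure \<Rightarrow> ('w \<Rightarrow> real^'d^'d) \<Rightarrow> ('w \<Rightarrow> real^'d) \<Rightarrow> (real^'d) measure \<Rightarrow> bool" where
  "stationary_distribution M A B \<nu> \<longleftrightarrow>
     prob_space \<nu> \<and> sets \<nu> = sets borel \<and>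
     distr (\<nu> \<Otimes>\<^sub>M M) borel (\<lambda>(x, \<omega>). A \<omega> *v x + B \<omega>) = \<nu>"

definition measure_support :: "'a::topological_space measure \<Rightarrow> 'a set" where
  "measure_support \<nu> = {x. \<forall>U. open U \<longrightarrow> x \<in> U \<longrightarrow> emeasure \<nu> U > 0}"

text \<open>In \<^typ>\<open>enat\<close> the infimum of the empty set is \<open>\<infinity>\<close>.\<close>

definition exit_time ::
  "(nat \<Rightarrow> 'w \<Rightarrow> real^'d^'d) \<Rightarrow> (nat \<Rightarrow> 'w \<Rightarrow> real^'d) \<Rightarrow> real \<Rightarrow> real^'d \<Rightarrow> 'w \<Rightarrow> enat" where
  "exit_time As Bs R x \<omega> = Inf (enat ` {n. norm (affine_process As Bs x n \<omega>) > R})"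

end

(* A sufficiently small moment of the products Pi_n contracts because the Lyapunov exponent is
   negative, and E |Pi_n|^alpha has growth rate one. Interpolating between the two exponents,
   E |Pi_n|^s tends to 0 along a subsequence for s slightly below alpha and is unbounded for s > alpha.

   Lower bound: for s < alpha the moments E |X_n(x)|^s are bounded in n, so by Markov's inequality
   the process needs at least of order R^s steps to leave the ball of radius R.

   Upper bound: for s > alpha, nondegeneracy (h) turns the growth of E |Pi_n|^s into growth of
   E |Pi_n y|^s uniformly in the direction y, and the unbounded support of the stationary law
   excludes that the process started in a fixed ball stays small. Hence some N satisfies
   E |X_N(x)|^s >= |x|^s + 1 for every x, so that V(x) = sum over i < N of E |X_i(x)|^s increases by
   at least 1 per step. Optional stopping bounds E tau_R by E V at the exit time, and (g) says that
   the overshoot does not change its order R^s. *)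
theory Submission
  imports Defs
begin

section \<open>Submultiplicative and subadditive sequences\<close>

text \<open>The value 1 of \<open>h_moment\<close> fixes the growth of the moments at the single
  exponent alpha, while the two bounds need decay below alpha and growth above it. The link is a
  pointwise interpolation between powers with a free threshold, chosen geometric in the number of
  blocks. One anchor is a small exponent r with E |Pi_m|^r < 1, found by truncating |Pi_m| from
  below, so that its logarithm is integrable, and differentiating the moment at exponent 0.

  For the upper bound, the norm of a product may grow in directions that a given start does not
  excite. The first n_0 factors, independent of the later ones, repair this with a constant from
  compactness. Even then growth is visible only from starts with |x|^s above a constant D. A start
  in a ball is therefore coupled with a stationary start through the same noise.

  All exponents stay below a real beta strictly between alpha and alpha_+, which keeps moments and
  overshoots finite. The work is done on the product space of the law of (A, B), where the Markov
  property is Fubini's theorem for glued sequences.\<close>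

lemma fekete_root:
  fixes u :: "nat \<Rightarrow> real"
  assumes nonneg: "\<And>n. 0 \<le> u n"
    and sub: "\<And>m n. 1 \<le> m \<Longrightarrow> 1 \<le> n \<Longrightarrow> u (m + n) \<le> u m * u n"
  shows "(\<lambda>n. root n (u n)) \<longlonglongrightarrow> (INF n\<in>{1..}. root n (u n))"
proof -
  define L where "L = (INF n\<in>{1..}. root n (u n))"
  have bdd: "bdd_below ((\<lambda>n. root n (u n)) ` {1..})"
    by (rule bdd_belowI2[of _ 0]) (use nonneg in auto)
  have L_le: "L \<le> root n (u n)" if "1 \<le> n" for n
    unfolding L_def by (rule cINF_lower[OF bdd]) (use that in auto)
  have L_nonneg: "0 \<le> L"
    unfolding L_def by (rule cINF_greatest) (use nonneg in auto)
  \<comment> \<open>The usual logarithmic form of Fekete's argument is avoided so that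
    \<open>u n = 0\<close> is allowed. The infimum starts at 1 because \<open>root 0\<close> is
    constantly 0.\<close>
  have upper: "\<forall>\<^sub>F n in sequentially. root n (u n) < a" if La: "L < a" for a
  proof -
    obtain c where c: "L < c" "c < a" using dense[OF La] by blast
    hence c0: "0 < c" using L_nonneg by linarith
    have "\<exists>n\<in>{1..}. root n (u n) < c"
      using cINF_less_iff[OF _ bdd, of c] c(1) unfolding L_def by auto
    then obtain m where m: "1 \<le> m" "root m (u m) < c" by auto
    have um: "u m \<le> c ^ m"
      using m c0 nonneg[of m]
      by (metis less_eq_real_def less_le_trans power_mono real_root_ge_zero real_root_pow_pos2 zero_less_one not_one_le_zero gr0I)
    \<comment> \<open>K dominates \<open>u r / c ^ r\<close> for every remainder r below m, and the
      summand 1 covers the case n = m. Peeling off blocks of length m then costs a factor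
      \<open>c ^ m\<close> each and leaves K unchanged.\<close>
    define K where "K = 1 + (\<Sum>r<m. u r / c ^ r)"
    have sum_nn: "0 \<le> (\<Sum>r<m. u r / c ^ r)"
      by (intro sum_nonneg) (use nonneg c0 in auto)
    have bound: "u n \<le> K * c ^ n" if "1 \<le> n" for n
      using that
    proof (induction n rule: less_induct)
      case (less n)
      consider "n < m" | "n = m" | "m < n" by linarith
      then show ?case
      proof cases
        case 1
        have "u n / c ^ n \<le> (\<Sum>r<m. u r / c ^ r)"
          by (rule member_le_sum) (use 1 nonneg c0 in auto)
        hence "u n / c ^ n \<le> K" by (simp add: K_def)
        thus ?thesis using c0 by (simp add: field_simps)
      next
        case 2
        have "1 * c ^ n \<le> K * c ^ n"
          by (intro mult_right_mono) (use sum_nn c0 in \<open>auto simp: K_def\<close>)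
        thus ?thesis using um 2 by simp
      next
        case 3
        have "u n \<le> u (n - m) * u m" using sub[of "n - m" m] 3 m by simp
        also have "\<dots> \<le> (K * c ^ (n - m)) * c ^ m"
          by (intro mult_mono less.IH um) (use 3 m nonneg c0 sum_nn in \<open>auto simp: K_def\<close>)
        also have "\<dots> = K * c ^ n" using 3 by (simp add: power_add[symmetric])
        finally show ?thesis .
      qed
    qed
    have "(\<lambda>n. root n K * c) \<longlonglongrightarrow> 1 * c"
      by (intro tendsto_intros LIMSEQ_root_const) (use sum_nn in \<open>auto simp: K_def\<close>)
    hence "\<forall>\<^sub>F n in sequentially. root n K * c < a"
      by (rule order_tendstoD) (use c in simp)
    thus ?thesis using eventually_ge_at_top[of 1]
    proof eventually_elim
      case (elim n)
      have "root n (u n) \<le> root n (K * c ^ n)"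
        using elim bound[of n] by simp
      also have "\<dots> = root n K * c"
        using elim c0 by (simp add: real_root_mult real_root_power_cancel)
      finally show ?case using elim by simp
    qed
  qed
  show ?thesis unfolding L_def[symmetric]
  proof (rule order_tendstoI)
    fix a assume "a < L"
    thus "\<forall>\<^sub>F n in sequentially. a < root n (u n)"
      by (intro eventually_mono[OF eventually_ge_at_top[of 1]]) (use L_le in \<open>force\<close>)
  qed (rule upper)
qed

text \<open>Exponentiation reduces this to the multiplicative version. Nonnegativity keeps the limit
  at least 1, where the logarithm is continuous, so the limit is finite and nonnegative.\<close>

lemma fekete_nonneg:
  fixes u :: "nat \<Rightarrow> real"
  assumes nonneg: "\<And>n. 0 \<le> u n"
    and sub: "\<And>m n. 1 \<le> m \<Longrightarrow> 1 \<le> n \<Longrightarrow> u (m + n) \<le> u m + u n"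
  obtains l where "0 \<le> l" "(\<lambda>n. u n / real n) \<longlonglongrightarrow> l"
proof -
  define L where "L = (INF n\<in>{1..}. root n (exp (u n)))"
  have lim: "(\<lambda>n. root n (exp (u n))) \<longlonglongrightarrow> L"
    unfolding L_def by (rule fekete_root) (use sub in \<open>auto simp: exp_add[symmetric]\<close>)
  have L1: "1 \<le> L"
    unfolding L_def by (rule cINF_greatest) (use nonneg in auto)
  have "(\<lambda>n. ln (root n (exp (u n)))) \<longlonglongrightarrow> ln L"
    by (intro tendsto_intros lim) (use L1 in auto)
  moreover have "\<forall>\<^sub>F n in sequentially. ln (root n (exp (u n))) = u n / real n"
    using eventually_gt_at_top[of 0] by eventually_elim (simp add: ln_root)
  ultimately have "(\<lambda>n. u n / real n) \<longlonglongrightarrow> ln L"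
    by (rule Lim_transform_eventually)
  thus ?thesis using that[of "ln L"] L1 by simp
qed

section \<open>The operator norm\<close>

lemma opnorm_nonneg: "0 \<le> opnorm (Q :: real^'d^'d)"
  by (rule onorm_pos_le[OF matrix_vector_mul_bounded_linear])

lemma norm_matrix_vector_le: "norm (Q *v x) \<le> opnorm (Q :: real^'d^'d) * norm x"
  by (rule onorm[OF matrix_vector_mul_bounded_linear])

lemma opnorm_matrix_mult: "opnorm (P ** Q) \<le> opnorm (P :: real^'d^'d) * opnorm Q"
proof -
  have "opnorm (P ** Q) = onorm ((\<lambda>x. P *v x) \<circ> (\<lambda>x. Q *v x))"
    by (simp add: o_def matrix_vector_mul_assoc)
  also have "\<dots> \<le> opnorm P * opnorm Q"
    by (intro onorm_compose matrix_vector_mul_bounded_linear)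
  finally show ?thesis .
qed

lemma opnorm_le_norm: "opnorm (Q :: real^'d^'d) \<le> real (CARD('d) * CARD('d)) * norm Q"
proof -
  have "opnorm Q \<le> (\<Sum>i\<in>UNIV. \<Sum>j\<in>UNIV. \<bar>Q $ i $ j\<bar>)"
    by (rule onorm_le_matrix_component_sum)
  also have "\<dots> \<le> (\<Sum>i\<in>(UNIV::'d set). \<Sum>j\<in>(UNIV::'d set). norm Q)"
    by (intro sum_mono) (metis Finite_Cartesian_Product.norm_nth_le order_trans real_norm_def)
  finally show ?thesis by simp
qed

lemma opnorm_diff_le: "\<bar>opnorm P - opnorm Q\<bar> \<le> opnorm (P - Q :: real^'d^'d)"
proof -
  have tri: "opnorm P \<le> opnorm (P - Q) + opnorm Q" for P Q :: "real^'d^'d"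
  proof -
    have "opnorm P = onorm (\<lambda>x. (P - Q) *v x + Q *v x)"
      by (simp add: matrix_vector_mult_diff_rdistrib)
    also have "\<dots> \<le> opnorm (P - Q) + opnorm Q"
      by (intro onorm_triangle matrix_vector_mul_bounded_linear)
    finally show ?thesis .
  qed
  have "opnorm (Q - P) = onorm (\<lambda>x. - ((P - Q) *v x))"
    by (simp add: matrix_vector_mult_diff_rdistrib)
  hence "opnorm (Q - P) = opnorm (P - Q)" by (simp add: onorm_neg)
  with tri[of P Q] tri[of Q P] show ?thesis by linarith
qed

lemma continuous_opnorm: "continuous_on UNIV (opnorm :: real^'d^'d \<Rightarrow> real)"
proof (rule lipschitz_on_continuous_on)
  show "(real (CARD('d) * CARD('d)))-lipschitz_on UNIV (opnorm :: real^'d^'d \<Rightarrow> real)"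
    by (rule lipschitz_onI)
       (use order_trans[OF opnorm_diff_le opnorm_le_norm] in \<open>auto simp: dist_norm\<close>)
qed

text \<open>The longest row carries the norm up to the factor d. A single row is what condition (h)
  can handle, since an entry of \<open>Q *v y\<close> is the inner product of a row with y.\<close>

lemma opnorm_le_row:
  obtains i where "opnorm (Q :: real^'d^'d) \<le> real CARD('d) * norm (Q $ i)"
proof -
  define m where "m = Max (range (\<lambda>i. norm (Q $ i)))"
  have m: "norm (Q $ i) \<le> m" for i unfolding m_def by (rule Max_ge) auto
  have "m \<in> range (\<lambda>i. norm (Q $ i))" unfolding m_def by (rule Max_in) auto
  then obtain i where i: "m = norm (Q $ i)" by auto
  have "opnorm Q \<le> real CARD('d) * m"
  proof (rule onorm_le)
    fix x
    have "norm (Q *v x) \<le> (\<Sum>i\<in>UNIV. \<bar>(Q *v x) $ i\<bar>)" by (rule norm_le_l1_cart)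
    also have "\<dots> \<le> (\<Sum>i\<in>(UNIV::'d set). m * norm x)"
    proof (rule sum_mono)
      fix i :: 'd
      have "\<bar>(Q *v x) $ i\<bar> \<le> norm (Q $ i) * norm x"
        by (simp add: matrix_vector_mul_component Cauchy_Schwarz_ineq2)
      also have "\<dots> \<le> m * norm x" by (intro mult_right_mono m) simp
      finally show "\<bar>(Q *v x) $ i\<bar> \<le> m * norm x" .
    qed
    finally show "norm (Q *v x) \<le> real CARD('d) * m * norm x" by simp
  qed
  thus ?thesis using that i by simp
qed

section \<open>Measurability from joint continuity of the matrix operations\<close>

lemma continuous_matrix_vector_mult:
  assumes "continuous_on S f" "continuous_on S g"
  shows "continuous_on S (\<lambda>x. (f x :: real^'d^'d) *v g x)"
  unfolding matrix_vector_mult_def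
  by (intro continuous_on_vec_lambda continuous_intros continuous_on_component assms)

lemma continuous_matrix_matrix_mult:
  assumes "continuous_on S f" "continuous_on S g"
  shows "continuous_on S (\<lambda>x. (f x :: real^'d^'d) ** (g x :: real^'d^'d))"
  unfolding matrix_matrix_mult_def
  by (intro continuous_on_vec_lambda continuous_intros continuous_on_component assms)

lemma measurable_opnorm [measurable]:
  "f \<in> borel_measurable M \<Longrightarrow> (\<lambda>x. opnorm (f x :: real^'d^'d)) \<in> borel_measurable M"
  by (rule measurable_compose[OF _ borel_measurable_continuous_onI[OF continuous_opnorm]])

lemma measurable_matrix_vector_mult [measurable]:
  "f \<in> borel_measurable M \<Longrightarrow> g \<in> borel_measurable M \<Longrightarrow>
    (\<lambda>x. (f x :: real^'d^'d) *v g x) \<in> borel_measurable M"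
  by (rule borel_measurable_continuous_Pair[where H="\<lambda>P v. P *v v"])
     (auto intro!: continuous_matrix_vector_mult continuous_intros)

lemma measurable_matrix_matrix_mult [measurable]:
  "f \<in> borel_measurable M \<Longrightarrow> g \<in> borel_measurable M \<Longrightarrow>
    (\<lambda>x. (f x :: real^'d^'d) ** (g x :: real^'d^'d)) \<in> borel_measurable M"
  by (rule borel_measurable_continuous_Pair[where H="(**)"])
     (auto intro!: continuous_matrix_matrix_mult continuous_intros)

section \<open>Power inequalities\<close>

text \<open>Bounding the sum by twice the maximum gives one constant for exponents below and above
  1, so the moment estimates need no case distinction at 1.\<close>

lemma powr_add_le:
  fixes a b s :: real
  assumes "0 \<le> a" "0 \<le> b" "0 < s"
  shows "(a + b) powr s \<le> 2 powr s * (a powr s + b powr s)"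
proof -
  have "(a + b) powr s \<le> (2 * max a b) powr s"
    by (intro powr_mono2) (use assms in auto)
  also have "\<dots> = 2 powr s * max a b powr s" using assms by (simp add: powr_mult)
  also have "\<dots> \<le> 2 powr s * (a powr s + b powr s)"
    by (intro mult_left_mono) (auto simp: max_def)
  finally show ?thesis .
qed

text \<open>Up to T the first term alone suffices, beyond T the second. The freedom in T takes the
  role of convexity of the moments in the exponent: it can be tuned to the decay of one moment
  against the growth of the other.\<close>

lemma powr_interpolation:
  fixes y T :: real
  assumes "0 \<le> y" "0 < T" "r \<le> a" "a \<le> s"
  shows "y powr a \<le> T powr (a - r) * y powr r + T powr (a - s) * y powr s"
proof (cases "y \<le> T")
  case True
  have "y powr a = y powr (a - r) * y powr r" using assms by (simp add: powr_add[symmetric])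
  also have "\<dots> \<le> T powr (a - r) * y powr r"
    by (intro mult_right_mono powr_mono2) (use assms True in auto)
  finally show ?thesis by (simp add: add_increasing2)
next
  case False
  have "y powr a = y powr (a - s) * y powr s" using assms by (simp add: powr_add[symmetric])
  also have "\<dots> \<le> T powr (a - s) * y powr s"
    by (intro mult_right_mono powr_mono2') (use assms False in auto)
  finally show ?thesis by (simp add: add_increasing)
qed

section \<open>The process on sequence space\<close>

text \<open>Coordinate \<open>n\<close> of a sequence carries the pair with index \<open>n + 1\<close>.\<close>

definition coord_A :: "nat \<Rightarrow> (nat \<Rightarrow> (real^'d^'d) \<times> (real^'d)) \<Rightarrow> real^'d^'d" where
  "coord_A n \<omega> = fst (\<omega> (n - 1))"

definition coord_B :: "nat \<Rightarrow> (nat \<Rightarrow> (real^'d^'d) \<times> (real^'d)) \<Rightarrow> real^'d" where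
  "coord_B n \<omega> = snd (\<omega> (n - 1))"

abbreviation "process \<equiv> affine_process coord_A coord_B"
abbreviation "product \<equiv> mat_prod coord_A"

lemma process_cong:
  "(\<And>i. i < n \<Longrightarrow> \<omega> i = \<omega>' i) \<Longrightarrow> process x n \<omega> = process x n \<omega>'"
  by (induction n) (auto simp: coord_A_def coord_B_def)

lemma product_cong:
  "(\<And>i. i < n \<Longrightarrow> \<omega> i = \<omega>' i) \<Longrightarrow> product n \<omega> = product n \<omega>'"
  by (induction n) (auto simp: coord_A_def)

text \<open>Pathwise Markov property: \<open>comb_seq\<close> places a fresh sequence behind the
  first m coordinates, so the process restarts from its position at time m.\<close>

lemma process_comb_seq:
  "process x (m + n) (comb_seq m \<omega> \<omega>') = process (process x m \<omega>) n \<omega>'"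
proof (induction n)
  case 0
  show ?case by (simp, rule process_cong) (simp add: comb_seq_less)
next
  case (Suc n)
  have "comb_seq m \<omega> \<omega>' (m + n) = \<omega>' n"
    using comb_seq_add[of m \<omega> \<omega>' n] by (simp add: add.commute)
  with Suc show ?case by (simp add: coord_A_def coord_B_def)
qed

lemma product_comb_seq:
  "product (m + n) (comb_seq m \<omega> \<omega>') = product n \<omega>' ** product m \<omega>"
proof (induction n)
  case 0
  have "product m (comb_seq m \<omega> \<omega>') = product m \<omega>"
    by (rule product_cong) (simp add: comb_seq_less)
  thus ?case by simp
next
  case (Suc n)
  have "comb_seq m \<omega> \<omega>' (m + n) = \<omega>' n"
    using comb_seq_add[of m \<omega> \<omega>' n] by (simp add: add.commute)
  with Suc show ?case by (simp add: coord_A_def matrix_mul_assoc)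
qed

text \<open>Two paths driven by the same noise differ by \<open>product n \<omega>\<close> applied
  to the difference of their starts. Both the growth estimate and the coupling with a stationary
  start rest on this.\<close>

lemma process_affine: "process x n \<omega> = product n \<omega> *v x + process 0 n \<omega>"
  by (induction n) (auto simp: matrix_vector_mul_assoc matrix_vector_right_distrib)

text \<open>Here \<open>\<mu>\<close> is the law of the pair (A, B). The canonical product space
  supports shifting and gluing of sequences, which an arbitrary probability space does not.\<close>

locale affine_iid = prob_space \<mu>
  for \<mu> :: "((real^'d^'d) \<times> (real^'d)) measure" +
  assumes sets_mu [measurable_cong]: "sets \<mu> = sets borel"
begin

sublocale seq: sequence_space \<mu>
  by unfold_locales

abbreviation paths :: "(nat \<Rightarrow> (real^'d^'d) \<times> (real^'d)) measure" where
  "paths \<equiv> Pi\<^sub>M UNIV (\<lambda>_. \<mu>)"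

lemma measurable_fst_mu [measurable]: "fst \<in> borel_measurable \<mu>"
  unfolding measurable_cong_sets[OF sets_mu refl] borel_prod[symmetric] by measurable

lemma measurable_snd_mu [measurable]: "snd \<in> borel_measurable \<mu>"
  unfolding measurable_cong_sets[OF sets_mu refl] borel_prod[symmetric] by measurable

lemma measurable_coord_A [measurable]:
  "g \<in> measurable N paths \<Longrightarrow> (\<lambda>w. coord_A n (g w)) \<in> borel_measurable N"
  unfolding coord_A_def
  by (rule measurable_compose[OF _ measurable_fst_mu])
     (rule measurable_compose[OF _ measurable_component_singleton], auto)

lemma measurable_coord_B [measurable]:
  "g \<in> measurable N paths \<Longrightarrow> (\<lambda>w. coord_B n (g w)) \<in> borel_measurable N"
  unfolding coord_B_def
  by (rule measurable_compose[OF _ measurable_snd_mu])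
     (rule measurable_compose[OF _ measurable_component_singleton], auto)

lemma measurable_process [measurable]:
  assumes [measurable]: "f \<in> borel_measurable N" "g \<in> measurable N paths"
  shows "(\<lambda>w. process (f w) n (g w)) \<in> borel_measurable N"
  by (induction n) simp_all

lemma measurable_product [measurable]:
  assumes [measurable]: "g \<in> measurable N paths"
  shows "(\<lambda>w. product n (g w)) \<in> borel_measurable N"
  by (induction n) simp_all

text \<open>Gluing two independent sequences reproduces the product law. Conditioning on the first m
  steps thus becomes an iterated integral.\<close>

lemma nn_integral_comb_seq:
  assumes [measurable]: "f \<in> borel_measurable paths"
  shows "(\<integral>\<^sup>+\<omega>. f \<omega> \<partial>paths) = (\<integral>\<^sup>+\<omega>. \<integral>\<^sup>+\<omega>'. f (comb_seq m \<omega> \<omega>') \<partial>paths \<partial>paths)"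
proof -
  have "(\<integral>\<^sup>+\<omega>. f \<omega> \<partial>paths)
      = (\<integral>\<^sup>+\<omega>. f \<omega> \<partial>distr (paths \<Otimes>\<^sub>M paths) paths (\<lambda>(\<omega>, \<omega>'). comb_seq m \<omega> \<omega>'))"
    by (simp add: seq.PiM_comb_seq)
  also have "\<dots> = (\<integral>\<^sup>+p. f (comb_seq m (fst p) (snd p)) \<partial>(paths \<Otimes>\<^sub>M paths))"
    by (subst nn_integral_distr) (auto simp: split_beta' intro!: measurable_comb_seq)
  also have "\<dots> = (\<integral>\<^sup>+\<omega>. \<integral>\<^sup>+\<omega>'. f (comb_seq m \<omega> \<omega>') \<partial>paths \<partial>paths)"
    by (subst seq.P.nn_integral_fst[symmetric]) auto
  finally show ?thesis .
qed

lemma nn_integral_coord: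
  assumes [measurable]: "f \<in> borel_measurable \<mu>"
  shows "(\<integral>\<^sup>+\<omega>. f (\<omega> n) \<partial>paths) = (\<integral>\<^sup>+p. f p \<partial>\<mu>)"
proof -
  have "(\<integral>\<^sup>+p. f p \<partial>\<mu>) = (\<integral>\<^sup>+p. f p \<partial>distr paths \<mu> (\<lambda>\<omega>. \<omega> n))"
    by (simp add: seq.PiM_component)
  also have "\<dots> = (\<integral>\<^sup>+\<omega>. f (\<omega> n) \<partial>paths)"
    by (subst nn_integral_distr) auto
  finally show ?thesis ..
qed

lemma nn_integral_process_add:
  assumes [measurable]: "f \<in> borel_measurable borel"
  shows "(\<integral>\<^sup>+\<omega>. f (process x (m + n) \<omega>) \<partial>paths)
       = (\<integral>\<^sup>+\<omega>. \<integral>\<^sup>+\<omega>'. f (process (process x m \<omega>) n \<omega>') \<partial>paths \<partial>paths)"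
  by (subst nn_integral_comb_seq[of _ m]) (auto simp: process_comb_seq)

lemma nn_integral_process_1:
  assumes [measurable]: "f \<in> borel_measurable borel"
  shows "(\<integral>\<^sup>+\<omega>. f (process x 1 \<omega>) \<partial>paths) = (\<integral>\<^sup>+p. f (fst p *v x + snd p) \<partial>\<mu>)"
  by (subst nn_integral_coord[symmetric, of _ 0]) (auto simp: coord_A_def coord_B_def)

section \<open>Moments\<close>

definition mom :: "real \<Rightarrow> nat \<Rightarrow> ennreal" where
  "mom s n = norm_moment paths (product n) s"

definition emom :: "real \<Rightarrow> nat \<Rightarrow> real^'d \<Rightarrow> ennreal" where
  "emom s n x = (\<integral>\<^sup>+\<omega>. ennreal (norm (process x n \<omega>) powr s) \<partial>paths)"

lemma measurable_emom [measurable]: "emom s n \<in> borel_measurable borel"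
  unfolding emom_def by measurable

lemma emom_0 [simp]: "emom s 0 x = ennreal (norm x powr s)"
  by (simp add: emom_def seq.P.emeasure_space_1)

lemma emom_add: "emom s (m + n) x = (\<integral>\<^sup>+\<omega>. emom s n (process x m \<omega>) \<partial>paths)"
  unfolding emom_def by (subst nn_integral_process_add) auto

lemma emom_Suc: "emom s (Suc n) x = (\<integral>\<^sup>+p. emom s n (fst p *v x + snd p) \<partial>\<mu>)"
  using emom_add[of s 1 n x] nn_integral_process_1[of "emom s n" x] by simp

lemma mom_0: "mom s 0 = 1"
proof -
  have "opnorm (mat 1 :: real^'d^'d) = 1"
    using onorm_id[where 'a="real^'d"] by simp
  thus ?thesis by (simp add: mom_def norm_moment_def seq.P.emeasure_space_1)
qed

lemma mom_1: "mom s 1 = (\<integral>\<^sup>+p. ennreal (opnorm (fst p) powr s) \<partial>\<mu>)"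
  unfolding mom_def norm_moment_def
  by (subst nn_integral_coord[symmetric, of _ 0]) (auto simp: coord_A_def)

text \<open>Submultiplicativity of the norm, combined with independence of the first m and the next
  n matrices, which factorises the double integral.\<close>

lemma mom_add:
  assumes "0 \<le> s"
  shows "mom s (m + n) \<le> mom s m * mom s n"
proof -
  have "mom s (m + n) = (\<integral>\<^sup>+\<omega>. \<integral>\<^sup>+\<omega>'. ennreal (opnorm (product n \<omega>' ** product m \<omega>) powr s) \<partial>paths \<partial>paths)"
    unfolding mom_def norm_moment_def
    by (subst nn_integral_comb_seq[of _ m]) (auto simp: product_comb_seq)
  also have "\<dots> \<le> (\<integral>\<^sup>+\<omega>. \<integral>\<^sup>+\<omega>'. ennreal (opnorm (product m \<omega>) powr s)
      * ennreal (opnorm (product n \<omega>') powr s) \<partial>paths \<partial>paths)"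
  proof (intro nn_integral_mono)
    fix \<omega> \<omega>'
    have "opnorm (product n \<omega>' ** product m \<omega>) powr s
        \<le> (opnorm (product m \<omega>) * opnorm (product n \<omega>')) powr s"
      using opnorm_matrix_mult[of "product n \<omega>'" "product m \<omega>"]
      by (intro powr_mono2 assms opnorm_nonneg) (simp add: mult.commute)
    also have "\<dots> = opnorm (product m \<omega>) powr s * opnorm (product n \<omega>') powr s"
      by (simp add: powr_mult)
    finally show "ennreal (opnorm (product n \<omega>' ** product m \<omega>) powr s)
        \<le> ennreal (opnorm (product m \<omega>) powr s) * ennreal (opnorm (product n \<omega>') powr s)"
      by (simp add: ennreal_mult[symmetric] ennreal_leI)
  qed
  also have "\<dots> = mom s m * mom s n"
    unfolding mom_def norm_moment_def by (simp add: nn_integral_cmult nn_integral_multc)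
  finally show ?thesis .
qed

lemma mom_mult_le:
  assumes "0 \<le> s"
  shows "mom s (k * m) \<le> mom s m ^ k"
proof (induction k)
  case (Suc k)
  have "mom s (Suc k * m) \<le> mom s m * mom s (k * m)" using mom_add[OF assms, of m "k * m"] by simp
  also have "\<dots> \<le> mom s m * mom s m ^ k" by (intro mult_left_mono Suc) simp
  finally show ?case by simp
qed (simp add: mom_0)

lemma mom_finite:
  assumes "0 \<le> s" "mom s 1 < \<infinity>"
  shows "mom s n < \<infinity>"
proof -
  have "mom s n \<le> mom s 1 ^ n" using mom_mult_le[OF assms(1), of n 1] by simp
  also have "\<dots> < \<infinity>" using assms(2) by (simp add: power_less_top_ennreal)
  finally show ?thesis .
qed

lemma emom_le:
  assumes "0 < s"
  shows "emom s n x \<le> ennreal (2 powr s) * (mom s n * ennreal (norm x powr s) + emom s n 0)"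
proof -
  have "emom s n x \<le> (\<integral>\<^sup>+\<omega>. ennreal (2 powr s) * (ennreal (opnorm (product n \<omega>) powr s)
      * ennreal (norm x powr s) + ennreal (norm (process 0 n \<omega>) powr s)) \<partial>paths)"
    unfolding emom_def
  proof (intro nn_integral_mono)
    fix \<omega>
    have "norm (process x n \<omega>) \<le> opnorm (product n \<omega>) * norm x + norm (process 0 n \<omega>)"
      by (subst process_affine) (intro norm_triangle_le add_right_mono norm_matrix_vector_le)
    hence "norm (process x n \<omega>) powr s
        \<le> (opnorm (product n \<omega>) * norm x + norm (process 0 n \<omega>)) powr s"
      using assms by (intro powr_mono2) auto
    also have "\<dots> \<le> 2 powr s * ((opnorm (product n \<omega>) * norm x) powr s + norm (process 0 n \<omega>) powr s)"
      by (intro powr_add_le) (use assms in \<open>auto simp: opnorm_nonneg\<close>)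
    also have "\<dots> = 2 powr s * (opnorm (product n \<omega>) powr s * norm x powr s + norm (process 0 n \<omega>) powr s)"
      by (simp add: powr_mult opnorm_nonneg)
    finally show "ennreal (norm (process x n \<omega>) powr s) \<le> ennreal (2 powr s)
        * (ennreal (opnorm (product n \<omega>) powr s) * ennreal (norm x powr s) + ennreal (norm (process 0 n \<omega>) powr s))"
      by (simp add: ennreal_mult[symmetric] ennreal_plus[symmetric] ennreal_leI del: ennreal_plus)
  qed
  also have "\<dots> = ennreal (2 powr s) * (mom s n * ennreal (norm x powr s) + emom s n 0)"
    unfolding mom_def norm_moment_def emom_def
    by (simp add: nn_integral_cmult nn_integral_multc nn_integral_add)
  finally show ?thesis .
qed

lemma emom_zero_finite:
  assumes "0 < s" "mom s 1 < \<infinity>" "emom s 1 0 < \<infinity>"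
  shows "emom s n 0 < \<infinity>"
proof (induction n)
  case (Suc n)
  have "emom s (Suc n) 0 = (\<integral>\<^sup>+\<omega>. emom s 1 (process 0 n \<omega>) \<partial>paths)"
    using emom_add[of s n 1 0] by simp
  also have "\<dots> \<le> (\<integral>\<^sup>+\<omega>. ennreal (2 powr s)
      * (mom s 1 * ennreal (norm (process 0 n \<omega>) powr s) + emom s 1 0) \<partial>paths)"
    by (intro nn_integral_mono emom_le assms)
  also have "\<dots> = ennreal (2 powr s) * (mom s 1 * emom s n 0 + emom s 1 0)"
    by (simp add: nn_integral_cmult nn_integral_add seq.P.emeasure_space_1 emom_def)
  also have "\<dots> < \<infinity>"
    using Suc assms by (simp add: ennreal_mult_less_top)
  finally show ?case .
qed (use assms in simp)

lemma emom_finite: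
  assumes "0 < s" "mom s 1 < \<infinity>" "emom s 1 0 < \<infinity>"
  shows "emom s n x < \<infinity>"
proof -
  have "ennreal (2 powr s) * (mom s n * ennreal (norm x powr s) + emom s n 0) < \<infinity>"
    using mom_finite[of s n] emom_zero_finite[of s n] assms by (simp add: ennreal_mult_less_top)
  with emom_le[OF assms(1)] show ?thesis by (rule le_less_trans)
qed

end

section \<open>A negative Lyapunov exponent contracts small moments\<close>

text \<open>The power of z is convex in its exponent, so its slopes from exponent 0 increase. This
  supplies the upper half of a dominating function.\<close>

lemma powr_diff_quotient_le:
  fixes z t c :: real
  assumes "0 < z" "0 < t" "t \<le> c"
  shows "(z powr t - 1) / t \<le> (z powr c - 1) / c"
proof -
  have "exp ((1 - t / c) *\<^sub>R 0 + (t / c) *\<^sub>R (c * ln z)) \<le> (1 - t / c) * exp 0 + (t / c) * exp (c * ln z)"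
    using convex_onD[OF convex_on_exp[of 1], of "t / c" 0 "c * ln z"] assms by simp
  hence "z powr t \<le> 1 - t / c + t / c * z powr c" using assms by (simp add: powr_def)
  also have "\<dots> = 1 + (z powr c - 1) / c * t" by (simp add: algebra_simps diff_divide_distrib)
  finally show ?thesis using assms by (simp add: pos_divide_le_eq)
qed

text \<open>The moment of order s equals 1 at s = 0 and has derivative E ln Z < 0 there, so it drops
  below 1 for small s. The derivative is passed through the integral by dominated convergence of
  difference quotients. The bound a lets the caller place s below any prescribed exponent.\<close>

lemma (in prob_space) small_moment_less_1:
  fixes Z :: "'a \<Rightarrow> real"
  assumes [measurable]: "Z \<in> borel_measurable M"
    and pos: "\<And>\<omega>. 0 < Z \<omega>"
    and r: "0 < r" "integrable M (\<lambda>\<omega>. Z \<omega> powr r)"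
    and ln: "integrable M (\<lambda>\<omega>. ln (Z \<omega>))" "(\<integral>\<omega>. ln (Z \<omega>) \<partial>M) < 0"
    and a: "0 < a"
  obtains s where "0 < s" "s < a" "integrable M (\<lambda>\<omega>. Z \<omega> powr s)" "(\<integral>\<omega>. Z \<omega> powr s \<partial>M) < 1"
proof -
  \<comment> \<open>Exponents up to c have integrable powers because they are at most r, and they
    stay strictly below a.\<close>
  define c where "c = min r (a / 2)"
  have c: "0 < c" "c \<le> r" "c < a" using r a by (auto simp: c_def)
  define t where "t = (\<lambda>k::nat. c / (real k + 1))"
  have t: "0 < t k" "t k \<le> c" for k using c by (auto simp: t_def field_simps)
  have t0: "t \<longlonglongrightarrow> 0" unfolding t_def by real_asymp
  have int: "integrable M (\<lambda>\<omega>. Z \<omega> powr s)" if "0 < s" "s \<le> r" for s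
  proof (rule Bochner_Integration.integrable_bound)
    show "integrable M (\<lambda>\<omega>. 1 + Z \<omega> powr r)" using r by auto
    have "Z \<omega> powr s \<le> 1 + Z \<omega> powr r" for \<omega>
    proof (cases "Z \<omega> \<le> 1")
      case True
      hence "Z \<omega> powr s \<le> 1" using pos[of \<omega>] that powr_mono2[of s "Z \<omega>" 1] by simp
      thus ?thesis by (simp add: add_increasing2)
    next
      case False
      thus ?thesis using that powr_mono[of s r "Z \<omega>"] by linarith
    qed
    thus "AE \<omega> in M. norm (Z \<omega> powr s) \<le> norm (1 + Z \<omega> powr r)" by simp
  qed auto
  define f where "f = (\<lambda>k \<omega>. (Z \<omega> powr t k - 1) / t k)"
  \<comment> \<open>The lower bound is \<open>1 + u \<le> exp u\<close>. Together with the monotone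
    slopes it dominates all quotients by one integrable function.\<close>
  have lower: "ln (Z \<omega>) \<le> f k \<omega>" for k \<omega>
    using exp_ge_add_one_self[of "t k * ln (Z \<omega>)"] t[of k] pos[of \<omega>]
    by (simp add: f_def powr_def field_simps)
  have upper: "f k \<omega> \<le> (Z \<omega> powr c - 1) / c" for k \<omega>
    unfolding f_def by (rule powr_diff_quotient_le) (use t pos in auto)
  have lim: "(\<lambda>k. f k \<omega>) \<longlonglongrightarrow> ln (Z \<omega>)" for \<omega>
  proof -
    have "((\<lambda>x. Z \<omega> powr x) has_real_derivative ln (Z \<omega>)) (at 0)"
      using pos[of \<omega>] by (auto intro!: derivative_eq_intros)
    hence "((\<lambda>h. (Z \<omega> powr h - 1) / h) \<longlongrightarrow> ln (Z \<omega>)) (at 0)"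
      using pos[of \<omega>] by (simp add: DERIV_def)
    moreover have "filterlim t (at 0) sequentially"
      unfolding filterlim_at using t0 t(1) by (auto simp: less_imp_neq[symmetric] intro!: always_eventually)
    ultimately show ?thesis unfolding f_def by (rule filterlim_compose)
  qed
  have "(\<lambda>k. \<integral>\<omega>. f k \<omega> \<partial>M) \<longlonglongrightarrow> (\<integral>\<omega>. ln (Z \<omega>) \<partial>M)"
  proof (rule integral_dominated_convergence)
    show "integrable M (\<lambda>\<omega>. \<bar>ln (Z \<omega>)\<bar> + \<bar>(Z \<omega> powr c - 1) / c\<bar>)"
      using int[of c] c ln by auto
    show "AE \<omega> in M. norm (f k \<omega>) \<le> \<bar>ln (Z \<omega>)\<bar> + \<bar>(Z \<omega> powr c - 1) / c\<bar>" for k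
    proof (rule always_eventually, rule allI)
      fix \<omega>
      show "norm (f k \<omega>) \<le> \<bar>ln (Z \<omega>)\<bar> + \<bar>(Z \<omega> powr c - 1) / c\<bar>"
        using lower[of \<omega> k] upper[of k \<omega>] unfolding real_norm_def by linarith
    qed
  qed (use lim in \<open>auto simp: f_def\<close>)
  hence "\<forall>\<^sub>F k in sequentially. (\<integral>\<omega>. f k \<omega> \<partial>M) < 0" by (rule order_tendstoD) (rule ln)
  then obtain k where k: "(\<integral>\<omega>. f k \<omega> \<partial>M) < 0" by (auto simp: eventually_sequentially)
  have intk: "integrable M (\<lambda>\<omega>. Z \<omega> powr t k)"
    by (rule int) (use t[of k] c in auto)
  have "(\<integral>\<omega>. f k \<omega> \<partial>M) = ((\<integral>\<omega>. Z \<omega> powr t k \<partial>M) - 1) / t k"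
    unfolding f_def using intk by (simp add: prob_space)
  with k t(1)[of k] have "(\<integral>\<omega>. Z \<omega> powr t k \<partial>M) < 1" by (simp add: divide_less_0_iff)
  with that[of "t k"] intk t[of k] c show ?thesis by auto
qed

section \<open>Subadditivity of the expected log norm\<close>

definition log_pos :: "real \<Rightarrow> ennreal" where
  "log_pos y = ennreal (ln (max y 1))"

text \<open>For y above 1 the conversion \<open>ennreal\<close> already truncates to 0. Only y = 0
  needs its own case, since \<open>ln 0 = 0\<close> would hide the infinite negative part.\<close>

definition log_neg :: "real \<Rightarrow> ennreal" where
  "log_neg y = (if y = 0 then \<infinity> else ennreal (- ln y))"

lemma measurable_log_pos [measurable]: "log_pos \<in> borel_measurable borel"
  unfolding log_pos_def by measurable

lemma measurable_log_neg [measurable]: "log_neg \<in> borel_measurable borel"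
  unfolding log_neg_def by measurable

lemma e2ennreal_log_ext:
  assumes "0 \<le> y"
  shows "e2ennreal (log_ext (ennreal y)) = log_pos y"
proof (cases "y = 0")
  case False
  hence "ennreal (ln y) = ennreal (ln (max y 1))"
    using assms by (auto simp: max_def ennreal_neg)
  thus ?thesis using assms False by (auto simp: log_ext_def log_pos_def)
qed (simp add: log_ext_def log_pos_def e2ennreal_neg)

lemma e2ennreal_uminus_log_ext:
  assumes "0 \<le> y"
  shows "e2ennreal (- log_ext (ennreal y)) = log_neg y"
  using assms by (auto simp: log_ext_def log_neg_def)

text \<open>Subadditivity of the logarithm, rearranged so that every part occurs with a plus sign.
  In this form it survives infinite negative parts and can be integrated without
  subtraction.\<close>

lemma log_pos_neg_mult:
  assumes "0 \<le> x" "0 \<le> y" "0 \<le> z" "z \<le> x * y"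
  shows "log_pos z + log_neg x + log_neg y \<le> log_pos x + log_pos y + log_neg z"
proof (cases "z = 0")
  case False
  hence pos: "0 < z" "0 < x" "0 < y" using assms by (auto simp: less_le)
  have "ln z \<le> ln (x * y)" using assms pos by simp
  hence "ln z \<le> ln x + ln y" using pos by (simp add: ln_mult)
  hence "max 0 (ln z) + max 0 (- ln x) + max 0 (- ln y)
      \<le> max 0 (ln x) + max 0 (ln y) + max 0 (- ln z)" by linarith
  hence "ennreal (max 0 (ln z) + max 0 (- ln x) + max 0 (- ln y))
      \<le> ennreal (max 0 (ln x) + max 0 (ln y) + max 0 (- ln z))" by (rule ennreal_leI)
  moreover have "log_pos w = ennreal (max 0 (ln w))" if "0 < w" for w
    using that by (auto simp: log_pos_def max_def)
  moreover have "log_neg w = ennreal (max 0 (- ln w))" if "0 < w" for w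
    using that by (auto simp: log_neg_def max_def ennreal_neg)
  ultimately show ?thesis using pos by (simp add: ennreal_plus)
qed (simp add: log_neg_def)

lemma log_pos_le_powr:
  assumes "0 \<le> y" "0 < r"
  shows "log_pos y \<le> ennreal (1 / r) * ennreal (y powr r)"
proof -
  have "ln (max y 1) \<le> 1 / r * y powr r"
  proof (cases "y \<le> 1")
    case False
    have "1 + r * ln y \<le> y powr r"
      using exp_ge_add_one_self[of "r * ln y"] False by (simp add: powr_def)
    hence "r * ln y \<le> y powr r" by linarith
    thus ?thesis using False assms by (simp add: field_simps max_def)
  qed (use assms in simp)
  thus ?thesis unfolding log_pos_def using assms
    by (simp add: ennreal_mult[symmetric] ennreal_leI)
qed

context affine_iid
begin

definition log_moment_pos :: "nat \<Rightarrow> ennreal" where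
  "log_moment_pos n = (\<integral>\<^sup>+\<omega>. log_pos (opnorm (product n \<omega>)) \<partial>paths)"

definition log_moment_neg :: "nat \<Rightarrow> ennreal" where
  "log_moment_neg n = (\<integral>\<^sup>+\<omega>. log_neg (opnorm (product n \<omega>)) \<partial>paths)"

lemma expectation_log_opnorm:
  "expectation_ext paths (\<lambda>\<omega>. log_ext (ennreal (opnorm (product n \<omega>))))
    = enn2ereal (log_moment_pos n) - enn2ereal (log_moment_neg n)"
  by (simp add: expectation_ext_def log_moment_pos_def log_moment_neg_def
      e2ennreal_log_ext e2ennreal_uminus_log_ext opnorm_nonneg)

lemma log_moment_add:
  "log_moment_pos (m + n) + log_moment_neg m + log_moment_neg n
    \<le> log_moment_pos m + log_moment_pos n + log_moment_neg (m + n)"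
proof -
  have "log_moment_pos (m + n) + log_moment_neg m + log_moment_neg n
    = (\<integral>\<^sup>+\<omega>. \<integral>\<^sup>+\<omega>'. (log_pos (opnorm (product (m + n) (comb_seq m \<omega> \<omega>')))
        + log_neg (opnorm (product m \<omega>)) + log_neg (opnorm (product n \<omega>'))) \<partial>paths \<partial>paths)"
    unfolding log_moment_pos_def log_moment_neg_def
    by (subst nn_integral_comb_seq[of _ m])
       (auto simp: product_comb_seq nn_integral_add seq.P.emeasure_space_1)
  also have "\<dots> \<le> (\<integral>\<^sup>+\<omega>. \<integral>\<^sup>+\<omega>'. (log_pos (opnorm (product m \<omega>)) + log_pos (opnorm (product n \<omega>'))
        + log_neg (opnorm (product (m + n) (comb_seq m \<omega> \<omega>')))) \<partial>paths \<partial>paths)"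
    by (intro nn_integral_mono log_pos_neg_mult opnorm_nonneg)
       (metis product_comb_seq mult.commute opnorm_matrix_mult)
  also have "\<dots> = log_moment_pos m + log_moment_pos n + log_moment_neg (m + n)"
    unfolding log_moment_pos_def log_moment_neg_def
    by (subst (4) nn_integral_comb_seq[of _ m])
       (auto simp: product_comb_seq nn_integral_add seq.P.emeasure_space_1)
  finally show ?thesis .
qed

lemma log_moment_pos_finite:
  assumes "0 < r" "mom r 1 < \<infinity>"
  shows "log_moment_pos n < \<infinity>"
proof -
  have "log_moment_pos n \<le> (\<integral>\<^sup>+\<omega>. ennreal (1 / r) * ennreal (opnorm (product n \<omega>) powr r) \<partial>paths)"
    unfolding log_moment_pos_def by (intro nn_integral_mono log_pos_le_powr opnorm_nonneg assms)
  also have "\<dots> = ennreal (1 / r) * mom r n"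
    by (simp add: nn_integral_cmult mom_def norm_moment_def)
  also have "\<dots> < \<infinity>" using mom_finite[of r n] assms by (simp add: ennreal_mult_less_top)
  finally show ?thesis .
qed

text \<open>Argued by contradiction, because the failure of the claim is what makes the negative
  parts finite. Then the expectations are real, nonnegative and subadditive, Fekete's lemma shows
  that the limit defining the Lyapunov exponent exists, and it is nonnegative.\<close>

lemma lyapunov_neg_imp_log_moment:
  assumes "0 < r" "mom r 1 < \<infinity>" and neg: "lyapunov_exponent paths coord_A < 0"
  obtains (contra) m where "1 \<le> m" "log_moment_pos m < log_moment_neg m"
proof (rule ccontr)
  assume neg_thesis: "\<not> thesis"
  have le: "log_moment_neg m \<le> log_moment_pos m" if m: "1 \<le> m" for m
    using m neg_thesis contra[of m] by (meson not_le)
  have fin_pos: "log_moment_pos n < \<infinity>" for n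
    by (rule log_moment_pos_finite) (use assms in auto)
  have fin_neg: "log_moment_neg n < \<infinity>" if "1 \<le> n" for n
    using le[OF that] fin_pos[of n] by (rule le_less_trans)
  \<comment> \<open>Index 0 is set to 0 because the comparison \<open>le\<close> and the finiteness
    of the negative parts are available only from index 1 on.\<close>
  define u where "u n = (if n = 0 then 0 else enn2real (log_moment_pos n) - enn2real (log_moment_neg n))" for n
  have "0 \<le> u n" for n
    using le[of n] fin_pos[of n] by (auto simp: u_def intro!: enn2real_mono)
  moreover have "u (m + n) \<le> u m + u n" if "1 \<le> m" "1 \<le> n" for m n
  proof -
    have eq: "log_moment_pos k = ennreal (enn2real (log_moment_pos k))"
      "log_moment_neg k = ennreal (enn2real (log_moment_neg k))" if "1 \<le> k" for k
      using fin_pos[of k] fin_neg[OF that] by simp_all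
    have "ennreal (enn2real (log_moment_pos (m + n)) + enn2real (log_moment_neg m) + enn2real (log_moment_neg n))
        \<le> ennreal (enn2real (log_moment_pos m) + enn2real (log_moment_pos n) + enn2real (log_moment_neg (m + n)))"
      using log_moment_add[of m n] eq[of m] eq[of n] eq[of "m + n"] that by simp
    hence "enn2real (log_moment_pos (m + n)) + enn2real (log_moment_neg m) + enn2real (log_moment_neg n)
        \<le> enn2real (log_moment_pos m) + enn2real (log_moment_pos n) + enn2real (log_moment_neg (m + n))"
      by (subst (asm) ennreal_le_iff) auto
    thus ?thesis using that by (simp add: u_def)
  qed
  ultimately obtain l where l: "0 \<le> l" "(\<lambda>n. u n / real n) \<longlonglongrightarrow> l"
    using fekete_nonneg[of u] by blast
  have "(\<lambda>n. ereal (u n / real n)) \<longlonglongrightarrow> ereal l" using l by simp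
  moreover have "\<forall>\<^sub>F n in sequentially. ereal (u n / real n)
    = expectation_ext paths (\<lambda>\<omega>. log_ext (ennreal (opnorm (product n \<omega>)))) / ereal (real n)"
    using eventually_ge_at_top[of 1]
  proof eventually_elim
    case (elim n)
    obtain p where p: "log_moment_pos n = ennreal p" "0 \<le> p"
      using fin_pos[of n] by (cases "log_moment_pos n") auto
    obtain q where q: "log_moment_neg n = ennreal q" "0 \<le> q"
      using fin_neg[OF elim] by (cases "log_moment_neg n") auto
    show ?case using elim by (simp add: expectation_log_opnorm u_def p q)
  qed
  ultimately have "lyapunov_exponent paths coord_A = ereal l"
    unfolding lyapunov_exponent_def by (intro limI) (rule Lim_transform_eventually)
  with l neg show False by simp
qed

text \<open>The norm may vanish or have a non-integrable logarithm. It is replaced by its maximum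
  with a small positive constant, which only increases the moments, while monotone convergence keeps
  the expected logarithm negative if the constant is small enough.\<close>

lemma lyapunov_neg_imp_mom_less_1:
  assumes "0 < r" "mom r 1 < \<infinity>" and neg: "lyapunov_exponent paths coord_A < 0" and a: "0 < a"
  obtains m s where "1 \<le> m" "0 < s" "s < a" "mom s m < 1"
proof -
  obtain m where m: "1 \<le> m" "log_moment_pos m < log_moment_neg m"
    using lyapunov_neg_imp_log_moment[OF assms(1-3)] by blast
  define y where "y = (\<lambda>\<omega>. opnorm (product m \<omega> :: real^'d^'d))"
  have [measurable]: "y \<in> borel_measurable paths" unfolding y_def by measurable
  have y: "0 \<le> y \<omega>" for \<omega> by (simp add: y_def opnorm_nonneg)
  \<comment> \<open>Negative parts of the logarithm of the truncated norm. They increase to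
    \<open>log_neg\<close>, so some truncation level already exceeds
    \<open>log_moment_pos m\<close>.\<close>
  define f where "f = (\<lambda>k \<omega>. ennreal (- ln (max (y \<omega>) (1 / (real k + 1)))))"
  have "(\<lambda>k. integral\<^sup>N paths (f k)) \<longlonglongrightarrow> (\<integral>\<^sup>+\<omega>. log_neg (y \<omega>) \<partial>paths)"
  proof (rule nn_integral_LIMSEQ)
    show "incseq f"
    proof (intro incseq_SucI le_funI)
      fix k \<omega>
      have "max (y \<omega>) (1 / (real (Suc k) + 1)) \<le> max (y \<omega>) (1 / (real k + 1))"
        by (intro max.mono) (auto simp: field_simps)
      hence "ln (max (y \<omega>) (1 / (real (Suc k) + 1))) \<le> ln (max (y \<omega>) (1 / (real k + 1)))"
        by (subst ln_le_cancel_iff) (auto simp: less_max_iff_disj)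
      thus "f k \<omega> \<le> f (Suc k) \<omega>" unfolding f_def by (intro ennreal_leI) simp
    qed
    show "f k \<in> borel_measurable paths" for k unfolding f_def by measurable
    show "(\<lambda>k. f k \<omega>) \<longlonglongrightarrow> log_neg (y \<omega>)" for \<omega>
    proof (cases "y \<omega> = 0")
      case True
      have "filterlim (\<lambda>k. - ln (1 / (real k + 1))) at_top sequentially" by real_asymp
      hence "((\<lambda>k. ennreal (- ln (1 / (real k + 1)))) \<longlonglongrightarrow> \<top>)"
        by (subst ennreal_tendsto_top_eq_at_top)
      moreover have "max 0 (1 / (real k + 1)) = 1 / (real k + 1)" for k by simp
      ultimately show ?thesis using True by (simp add: f_def log_neg_def)
    next
      case False
      hence "0 < y \<omega>" using y[of \<omega>] by simp
      moreover have "(\<lambda>k. 1 / (real k + 1)) \<longlonglongrightarrow> 0" by real_asymp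
      ultimately have "\<forall>\<^sub>F k in sequentially. 1 / (real k + 1) < y \<omega>"
        by (intro order_tendstoD(2)) auto
      hence "\<forall>\<^sub>F k in sequentially. log_neg (y \<omega>) = f k \<omega>"
        by eventually_elim (use False in \<open>auto simp: f_def log_neg_def max_def\<close>)
      thus ?thesis by (rule Lim_transform_eventually[OF tendsto_const])
    qed
  qed
  hence "\<forall>\<^sub>F k in sequentially. log_moment_pos m < integral\<^sup>N paths (f k)"
    by (rule order_tendstoD) (use m in \<open>simp add: log_moment_neg_def y_def\<close>)
  then obtain k where k: "log_moment_pos m < integral\<^sup>N paths (f k)"
    by (auto simp: eventually_sequentially)
  define \<delta> where "\<delta> = 1 / (real k + 1)"
  have \<delta>: "0 < \<delta>" "\<delta> \<le> 1" by (auto simp: \<delta>_def)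
  define Z where "Z = (\<lambda>\<omega>. max (y \<omega>) \<delta>)"
  have [measurable]: "Z \<in> borel_measurable paths" unfolding Z_def by measurable
  have Z: "\<delta> \<le> Z \<omega>" "0 < Z \<omega>" for \<omega> using \<delta> by (auto simp: Z_def)
  have pos: "(\<integral>\<^sup>+\<omega>. ennreal (ln (Z \<omega>)) \<partial>paths) = log_moment_pos m"
    unfolding log_moment_pos_def
  proof (intro nn_integral_cong)
    fix \<omega>
    show "ennreal (ln (Z \<omega>)) = log_pos (opnorm (product m \<omega>))"
      using \<delta> y[of \<omega>] unfolding Z_def log_pos_def y_def
      by (auto simp: max_def ennreal_neg not_le)
  qed
  have neg: "(\<integral>\<^sup>+\<omega>. ennreal (- ln (Z \<omega>)) \<partial>paths) = integral\<^sup>N paths (f k)"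
    by (simp add: Z_def f_def \<delta>_def)
  have int_ln: "integrable paths (\<lambda>\<omega>. ln (Z \<omega>))"
  proof (subst real_integrable_def, intro conjI)
    show "(\<integral>\<^sup>+\<omega>. ennreal (ln (Z \<omega>)) \<partial>paths) \<noteq> \<infinity>"
      using pos log_moment_pos_finite[OF assms(1,2), of m] by simp
    have "(\<integral>\<^sup>+\<omega>. ennreal (- ln (Z \<omega>)) \<partial>paths) \<le> (\<integral>\<^sup>+\<omega>. ennreal (- ln \<delta>) \<partial>paths)"
      by (intro nn_integral_mono ennreal_leI) (use Z \<delta> in \<open>simp add: ln_le_cancel_iff\<close>)
    also have "\<dots> < \<infinity>" by (simp add: seq.P.emeasure_space_1)
    finally show "(\<integral>\<^sup>+\<omega>. ennreal (- ln (Z \<omega>)) \<partial>paths) \<noteq> \<infinity>" by simp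
  qed simp
  have "(\<integral>\<omega>. ln (Z \<omega>) \<partial>paths) = enn2real (log_moment_pos m) - enn2real (integral\<^sup>N paths (f k))"
    by (simp add: real_lebesgue_integral_def[OF int_ln] pos neg)
  moreover have "integral\<^sup>N paths (f k) < \<infinity>"
    using int_ln unfolding real_integrable_def neg by (simp add: less_top)
  ultimately have ln_neg: "(\<integral>\<omega>. ln (Z \<omega>) \<partial>paths) < 0"
    using k by (cases "log_moment_pos m"; cases "integral\<^sup>N paths (f k)") (auto simp: ennreal_less_iff)
  have int_r: "integrable paths (\<lambda>\<omega>. Z \<omega> powr r)"
  proof (rule integrableI_nonneg)
    have "(\<integral>\<^sup>+\<omega>. ennreal (Z \<omega> powr r) \<partial>paths) \<le> (\<integral>\<^sup>+\<omega>. ennreal (y \<omega> powr r) + 1 \<partial>paths)"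
    proof (intro nn_integral_mono)
      fix \<omega>
      have "Z \<omega> powr r \<le> y \<omega> powr r + 1"
        using \<delta> powr_mono2[of r \<delta> 1] assms(1) by (auto simp: Z_def max_def add_increasing)
      hence "ennreal (Z \<omega> powr r) \<le> ennreal (y \<omega> powr r + 1)" by (rule ennreal_leI)
      thus "ennreal (Z \<omega> powr r) \<le> ennreal (y \<omega> powr r) + 1" by simp
    qed
    also have "\<dots> = mom r m + 1"
      by (simp add: nn_integral_add mom_def norm_moment_def y_def seq.P.emeasure_space_1)
    also have "\<dots> < \<infinity>" using mom_finite[of r m] assms by simp
    finally show "(\<integral>\<^sup>+\<omega>. ennreal (Z \<omega> powr r) \<partial>paths) < \<infinity>" .
  qed auto
  obtain s where s: "0 < s" "s < a" "integrable paths (\<lambda>\<omega>. Z \<omega> powr s)" "(\<integral>\<omega>. Z \<omega> powr s \<partial>paths) < 1"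
    by (rule seq.P.small_moment_less_1[of Z r a]) (use Z assms int_r int_ln ln_neg in auto)
  have "mom s m \<le> (\<integral>\<^sup>+\<omega>. ennreal (Z \<omega> powr s) \<partial>paths)"
    unfolding mom_def norm_moment_def y_def[symmetric]
    by (intro nn_integral_mono ennreal_leI powr_mono2) (use s in \<open>auto simp: Z_def y_def opnorm_nonneg\<close>)
  also have "\<dots> = ennreal (\<integral>\<omega>. Z \<omega> powr s \<partial>paths)"
    by (rule nn_integral_eq_integral) (use s in auto)
  also have "\<dots> < 1" using s(4) by (simp add: ennreal_less_one_iff)
  finally show ?thesis using that m(1) s by blast
qed

end

section \<open>Moments below and above the critical exponent\<close>

context affine_iid
begin

text \<open>By Fekete's lemma the limit is also the infimum. The infimum gives the lower bound at
  every n, the limit the subexponential upper bound for large n.\<close>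

lemma h_moment_eq_1_imp:
  assumes a: "0 < a" "mom a 1 < \<infinity>" and h: "h_moment paths coord_A a = 1"
  shows h_moment_eq_1_imp_mom_ge_1: "\<And>n. 1 \<le> n \<Longrightarrow> 1 \<le> mom a n"
    and h_moment_eq_1_imp_mom_le_power: "\<And>c. 1 < c \<Longrightarrow> \<forall>\<^sub>F n in sequentially. mom a n \<le> ennreal (c ^ n)"
proof -
  define v where "v n = enn2real (mom a n)" for n
  have v: "mom a n = ennreal (v n)" "0 \<le> v n" for n
    using mom_finite[of a n] a by (auto simp: v_def)
  have sub: "v (m + n) \<le> v m * v n" for m n
    using mom_add[of a m n] a v(2) by (simp add: v(1) ennreal_mult[symmetric])
  define L where "L = (INF n\<in>{1..}. root n (v n))"
  have lim: "(\<lambda>n. root n (v n)) \<longlonglongrightarrow> L"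
    unfolding L_def by (rule fekete_root) (use v sub in auto)
  have "h_moment paths coord_A a = lim (\<lambda>n. ennreal (root n (v n)))"
    unfolding h_moment_def mom_def[symmetric] root_ext_def v(1) using v(2) by simp
  also have "\<dots> = ennreal L"
    by (rule limI) (use lim in \<open>simp add: tendsto_ennrealI\<close>)
  finally have L: "L = 1" using h by (metis ennreal_eq_1)
  show "1 \<le> mom a n" if "1 \<le> n" for n
  proof -
    have "bdd_below ((\<lambda>n. root n (v n)) ` {1..})"
      by (rule bdd_belowI2[of _ 0]) (use v in auto)
    hence "L \<le> root n (v n)" unfolding L_def by (rule cINF_lower) (use that in auto)
    hence "1 \<le> v n" using L that by simp
    thus ?thesis by (simp add: v(1))
  qed
  show "\<forall>\<^sub>F n in sequentially. mom a n \<le> ennreal (c ^ n)" if "1 < c" for c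
  proof -
    have "\<forall>\<^sub>F n in sequentially. root n (v n) < c"
      using order_tendstoD(2)[OF lim, of c] L that by simp
    thus ?thesis using eventually_ge_at_top[of 1]
    proof eventually_elim
      case (elim n)
      have "v n = root n (v n) ^ n" using elim v(2)[of n] by simp
      also have "\<dots> \<le> c ^ n" by (intro power_mono) (use elim v in auto)
      finally show ?case by (simp add: v(1) ennreal_leI)
    qed
  qed
qed

lemma mom_interpolation:
  assumes "0 < T" "r \<le> a" "a \<le> s"
  shows "mom a n \<le> ennreal (T powr (a - r)) * mom r n + ennreal (T powr (a - s)) * mom s n"
proof -
  have "mom a n \<le> (\<integral>\<^sup>+\<omega>. ennreal (T powr (a - r)) * ennreal (opnorm (product n \<omega>) powr r)
      + ennreal (T powr (a - s)) * ennreal (opnorm (product n \<omega>) powr s) \<partial>paths)"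
    unfolding mom_def norm_moment_def
  proof (intro nn_integral_mono)
    fix \<omega>
    have "ennreal (opnorm (product n \<omega>) powr a) \<le> ennreal (T powr (a - r) * opnorm (product n \<omega>) powr r
        + T powr (a - s) * opnorm (product n \<omega>) powr s)"
      by (intro ennreal_leI powr_interpolation assms opnorm_nonneg)
    thus "ennreal (opnorm (product n \<omega>) powr a)
        \<le> ennreal (T powr (a - r)) * ennreal (opnorm (product n \<omega>) powr r)
          + ennreal (T powr (a - s)) * ennreal (opnorm (product n \<omega>) powr s)"
      by (simp add: ennreal_mult[symmetric] ennreal_plus[symmetric] del: ennreal_plus)
  qed
  thus ?thesis
    by (simp add: nn_integral_add nn_integral_cmult mom_def norm_moment_def)
qed

lemma mom_le_geometric:
  assumes "0 \<le> r" "mom r m < 1"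
  obtains \<rho> where "0 < \<rho>" "\<rho> < 1" "\<And>k. mom r (k * m) \<le> ennreal (\<rho> ^ k)"
proof -
  \<comment> \<open>The maximum with 1/2 keeps the ratio positive even if the moment vanishes, so
    that negative powers of it can serve as thresholds.\<close>
  define \<rho> where "\<rho> = max (1 / 2) (enn2real (mom r m))"
  obtain v where v: "mom r m = ennreal v" "0 \<le> v" "v < 1"
    using assms(2) by (cases "mom r m") (auto simp: ennreal_less_one_iff)
  have \<rho>: "0 < \<rho>" "\<rho> < 1" "v \<le> \<rho>" using v by (auto simp: \<rho>_def)
  have "mom r (k * m) \<le> ennreal (\<rho> ^ k)" for k
  proof -
    have "mom r (k * m) \<le> mom r m ^ k" by (rule mom_mult_le) (rule assms)
    also have "\<dots> = ennreal (v ^ k)" using v by (simp add: ennreal_power)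
    also have "\<dots> \<le> ennreal (\<rho> ^ k)" using v \<rho> by (intro ennreal_leI power_mono) auto
    finally show ?thesis .
  qed
  with \<rho> that show ?thesis by blast
qed

text \<open>Interpolation of s between r and a with threshold \<open>T ^ k\<close> after k blocks.
  The geometric decay at r pays for the first term; the negative power of T in the second beats the
  subexponential growth at a.\<close>

lemma mom_small_below_critical:
  assumes r: "0 < r" "1 \<le> m" "mom r m < 1" and s: "r < s" "s < a"
    and a: "mom a 1 < \<infinity>" "h_moment paths coord_A a = 1" and e: "0 < e"
  obtains k where "1 \<le> k" "mom s (k * m) < ennreal e"
proof -
  obtain \<rho> where \<rho>: "0 < \<rho>" "\<rho> < 1" "\<And>k. mom r (k * m) \<le> ennreal (\<rho> ^ k)"
    using mom_le_geometric[of r m] r by auto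
  \<comment> \<open>The exponent spends half of the decay at r: \<open>T powr (s - r)\<close> equals
    \<open>\<rho> powr (- 1 / 2)\<close>, so the first ratio p is
    \<open>\<rho> powr (1 / 2)\<close>.\<close>
  define T where "T = \<rho> powr (- 1 / (2 * (s - r)))"
  have T: "1 < T" unfolding T_def
    using powr_less_mono2_neg[of "- 1 / (2 * (s - r))" \<rho> 1] \<rho> s by (simp add: divide_neg_pos)
  define p where "p = T powr (s - r) * \<rho>"
  have exponent: "- 1 / (2 * (s - r)) * (s - r) = - 1 / 2" using s by (simp add: divide_simps)
  have "p = \<rho> powr (- 1 / 2) * \<rho> powr 1"
    unfolding p_def T_def powr_powr exponent using \<rho> by simp
  also have "\<dots> = \<rho> powr (1 / 2)" unfolding powr_add[symmetric] by simp
  finally have p: "0 \<le> p" "p < 1" using \<rho> powr_less_mono2[of "1 / 2" \<rho> 1] by auto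
  \<comment> \<open>Over a block of length m the growth allowed at a is
    \<open>T powr ((a - s) / 2)\<close>, half of what the threshold gains, so the second ratio q is
    still below 1.\<close>
  define c where "c = T powr ((a - s) / (2 * real m))"
  have c: "1 < c" unfolding c_def using T s r by (intro gr_one_powr) auto
  define q where "q = T powr (s - a) * c ^ m"
  have "c ^ m = T powr ((a - s) / 2)"
    using T r by (simp add: c_def powr_realpow[symmetric] powr_powr)
  hence "q = T powr ((s - a) / 2)" by (simp add: q_def powr_add[symmetric] field_simps)
  also have "\<dots> < 1" using T s by (simp add: powr_less_one)
  finally have q: "0 \<le> q" "q < 1" using T c by (auto simp: q_def)
  have "(\<lambda>k. p ^ k + q ^ k) \<longlonglongrightarrow> 0 + 0"
    by (intro tendsto_add LIMSEQ_power_zero) (use p q in auto)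
  hence ev1: "\<forall>\<^sub>F k in sequentially. p ^ k + q ^ k < e"
    by (rule order_tendstoD) (use e in simp)
  have "0 < a" using r s by simp
  from h_moment_eq_1_imp_mom_le_power[OF this a c]
  obtain n0 where n0: "\<And>n. n0 \<le> n \<Longrightarrow> mom a n \<le> ennreal (c ^ n)"
    by (auto simp: eventually_sequentially)
  from ev1 obtain k1 where k1: "\<And>k. k1 \<le> k \<Longrightarrow> p ^ k + q ^ k < e"
    by (auto simp: eventually_sequentially)
  define k where "k = max 1 (max n0 k1)"
  have "k * 1 \<le> k * m" using r by (intro mult_left_mono) auto
  hence km: "n0 \<le> k * m" by (simp add: k_def)
  have Tk: "(T ^ k) powr x = (T powr x) ^ k" for x
    using T by (simp add: powr_realpow[symmetric] powr_powr mult.commute)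
  have "mom s (k * m) \<le> ennreal ((T ^ k) powr (s - r)) * mom r (k * m) + ennreal ((T ^ k) powr (s - a)) * mom a (k * m)"
    by (rule mom_interpolation) (use T s in auto)
  also have "\<dots> \<le> ennreal ((T ^ k) powr (s - r)) * ennreal (\<rho> ^ k) + ennreal ((T ^ k) powr (s - a)) * ennreal (c ^ (k * m))"
    by (intro add_mono mult_left_mono \<rho>(3) n0 km) auto
  also have "\<dots> = ennreal (p ^ k + q ^ k)"
    using \<rho> c T by (simp add: ennreal_mult[symmetric] Tk p_def q_def power_mult_distrib
        power_mult mult.commute[of k] ennreal_plus[symmetric] del: ennreal_plus)
  also have "\<dots> < ennreal e" using k1[of k] e by (intro ennreal_lessI) (auto simp: k_def)
  finally show ?thesis using that[of k] by (simp add: k_def)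
qed

text \<open>If the moments at s were bounded along multiples of m, interpolating a between r and s
  with a geometric threshold would send the moments at a to 0, although they never fall below
  1.\<close>

lemma mom_unbounded_above_critical:
  assumes r: "0 < r" "1 \<le> m" "mom r m < 1" and s: "r < a" "a < s"
    and a: "mom a 1 < \<infinity>" "h_moment paths coord_A a = 1"
  obtains k where "ennreal K \<le> mom s (k * m)"
proof (rule ccontr)
  assume neg_thesis: "\<not> thesis"
  define L where "L = max K 0"
  have L: "0 \<le> L" by (simp add: L_def)
  have bound: "mom s (k * m) \<le> ennreal L" for k
  proof -
    have "mom s (k * m) \<le> ennreal K" using neg_thesis that[of k] by (meson nle_le)
    also have "\<dots> \<le> ennreal L" by (rule ennreal_leI) (simp add: L_def)
    finally show ?thesis .
  qed
  obtain \<rho> where \<rho>: "0 < \<rho>" "\<rho> < 1" "\<And>k. mom r (k * m) \<le> ennreal (\<rho> ^ k)"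
    using mom_le_geometric[of r m] r by auto
  define T where "T = \<rho> powr (- 1 / (2 * (a - r)))"
  have T: "1 < T" unfolding T_def
    using powr_less_mono2_neg[of "- 1 / (2 * (a - r))" \<rho> 1] \<rho> s by (simp add: divide_neg_pos)
  define p where "p = T powr (a - r) * \<rho>"
  have exponent: "- 1 / (2 * (a - r)) * (a - r) = - 1 / 2" using s by (simp add: divide_simps)
  have "p = \<rho> powr (- 1 / 2) * \<rho> powr 1"
    unfolding p_def T_def powr_powr exponent using \<rho> by simp
  also have "\<dots> = \<rho> powr (1 / 2)" unfolding powr_add[symmetric] by simp
  finally have p: "0 \<le> p" "p < 1" using \<rho> powr_less_mono2[of "1 / 2" \<rho> 1] by auto
  define q where "q = T powr (a - s)"
  have q: "0 \<le> q" "q < 1" using T s by (auto simp: q_def powr_less_one)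
  have "(\<lambda>k. p ^ k + q ^ k * L) \<longlonglongrightarrow> 0 + 0 * L"
    by (intro tendsto_intros LIMSEQ_power_zero) (use p q in auto)
  hence "\<forall>\<^sub>F k in sequentially. p ^ k + q ^ k * L < 1"
    by (rule order_tendstoD) simp
  then obtain k1 where k1: "\<And>k. k1 \<le> k \<Longrightarrow> p ^ k + q ^ k * L < 1"
    by (auto simp: eventually_sequentially)
  define k where "k = max 1 k1"
  have "1 \<le> k * m" using r by (simp add: k_def)
  have Tk: "(T ^ k) powr x = (T powr x) ^ k" for x
    using T by (simp add: powr_realpow[symmetric] powr_powr mult.commute)
  have "1 \<le> mom a (k * m)"
    by (rule h_moment_eq_1_imp_mom_ge_1) (use r s a \<open>1 \<le> k * m\<close> in auto)
  also have "\<dots> \<le> ennreal ((T ^ k) powr (a - r)) * mom r (k * m) + ennreal ((T ^ k) powr (a - s)) * mom s (k * m)"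
    by (rule mom_interpolation) (use T s in auto)
  also have "\<dots> \<le> ennreal ((T ^ k) powr (a - r)) * ennreal (\<rho> ^ k) + ennreal ((T ^ k) powr (a - s)) * ennreal (L)"
    by (intro add_mono mult_left_mono \<rho>(3) bound) auto
  also have "\<dots> = ennreal (p ^ k + q ^ k * L)"
    using \<rho> T L by (simp add: ennreal_mult[symmetric] Tk p_def q_def power_mult_distrib
        ennreal_plus[symmetric] del: ennreal_plus)
  also have "\<dots> < 1" using k1[of k] p q L by (subst ennreal_less_one_iff) (auto simp: k_def)
  finally show False by simp
qed

end

section \<open>Overshoot\<close>

text \<open>Levels \<open>z0 ^ k * R\<close> cut the region beyond R into layers. On layer k the
  power grows like \<open>z0 powr (k * s)\<close> while the tail decays like
  \<open>z0 powr (- k * \<beta>)\<close>, which leaves a geometric series because s < beta.\<close>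

lemma (in prob_space) overshoot_moment_le:
  fixes Y :: "'a \<Rightarrow> real"
  assumes [measurable]: "Y \<in> borel_measurable M"
    and s: "0 < s" "s < \<beta>" and R: "0 < R" and z0: "1 < z0"
    and tail: "\<And>z. z0 \<le> z \<Longrightarrow> measure M {\<omega>\<in>space M. z * R < Y \<omega>}
      \<le> C * z powr (- \<beta>) * measure M {\<omega>\<in>space M. R < Y \<omega>}"
  shows "(\<integral>\<^sup>+\<omega>. ennreal (Y \<omega> powr s) * indicator {R<..} (Y \<omega>) \<partial>M)
    \<le> ennreal (z0 powr s * max 1 C / (1 - z0 powr (s - \<beta>)) * R powr s) * emeasure M {\<omega>\<in>space M. R < Y \<omega>}"
proof -
  define q where "q = z0 powr (s - \<beta>)"
  have q: "0 < q" "q < 1" using z0 s by (auto simp: q_def powr_less_one)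
  define c where "c k = R powr s * z0 powr s * (z0 powr s) ^ k" for k
  define P where "P x = measure M {\<omega>\<in>space M. x < Y \<omega>}" for x
  define f where "f y k = ennreal (c k) * indicator {z0 ^ k * R<..} y" for y k
  have pointwise: "ennreal (y powr s) * indicator {R<..} y \<le> (\<Sum>k. f y k)" for y
  proof (cases "R < y")
    case True
    have "\<exists>n. y \<le> z0 ^ n * R"
      using real_arch_pow[OF z0, of "y / R"] R by (auto simp: field_simps intro: less_imp_le)
    define n where "n = (LEAST n. y \<le> z0 ^ n * R)"
    have n: "y \<le> z0 ^ n * R" unfolding n_def by (rule LeastI_ex) fact
    have "n \<noteq> 0" using n True by (cases n) auto
    then obtain k where k: "n = Suc k" by (cases n) auto
    have lt: "z0 ^ k * R < y" using not_less_Least[of k "\<lambda>n. y \<le> z0 ^ n * R"] k by (auto simp: n_def)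
    have "y powr s \<le> (z0 ^ Suc k * R) powr s"
      by (intro powr_mono2) (use n k s True R in auto)
    also have "\<dots> = c k" using z0 R s
      by (simp add: c_def powr_mult powr_realpow[symmetric] powr_powr powr_add[symmetric] algebra_simps)
    finally have "ennreal (y powr s) * indicator {R<..} y \<le> sum (f y) {k}"
      using lt True by (simp add: ennreal_leI f_def)
    also have "\<dots> \<le> (\<Sum>k. f y k)"
      by (rule sum_le_suminf) auto
    finally show ?thesis .
  qed simp
  \<comment> \<open>At k = 0 the ratio of levels is 1, below z0, so \<open>tail\<close> says
    nothing; the probability is compared with itself, whence the constant
    \<open>max 1 C\<close>.\<close>
  have term_le: "c k * P (z0 ^ k * R) \<le> (z0 powr s * R powr s * max 1 C) * q ^ k * P R" for k
  proof (cases "k = 0")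
    case True
    have "z0 powr s * R powr s * 1 * P R \<le> z0 powr s * R powr s * max 1 C * P R"
      by (intro mult_right_mono mult_left_mono) (auto simp: P_def)
    thus ?thesis using True by (simp add: c_def mult_ac)
  next
    case False
    have "z0 ^ 1 \<le> z0 ^ k" using z0 False by (intro power_increasing) auto
    hence "P (z0 ^ k * R) \<le> C * (z0 ^ k) powr (- \<beta>) * P R" using tail by (simp add: P_def)
    also have "\<dots> \<le> max 1 C * (z0 ^ k) powr (- \<beta>) * P R"
      by (intro mult_right_mono) (auto simp: P_def)
    finally have "c k * P (z0 ^ k * R) \<le> c k * (max 1 C * (z0 ^ k) powr (- \<beta>) * P R)"
      by (intro mult_left_mono) (auto simp: c_def)
    also have "\<dots> = (z0 powr s * R powr s * max 1 C) * ((z0 powr s) ^ k * (z0 ^ k) powr (- \<beta>)) * P R"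
      by (simp add: c_def mult_ac)
    also have "(z0 powr s) ^ k * (z0 ^ k) powr (- \<beta>) = q ^ k"
      using z0 by (simp add: q_def powr_realpow[symmetric] powr_powr powr_add[symmetric] algebra_simps)
    finally show ?thesis .
  qed
  have "(\<integral>\<^sup>+\<omega>. ennreal (Y \<omega> powr s) * indicator {R<..} (Y \<omega>) \<partial>M)
      \<le> (\<integral>\<^sup>+\<omega>. (\<Sum>k. ennreal (c k) * indicator {z0 ^ k * R<..} (Y \<omega>)) \<partial>M)"
    using pointwise by (intro nn_integral_mono) (simp add: f_def)
  also have "\<dots> = (\<Sum>k. \<integral>\<^sup>+\<omega>. ennreal (c k) * indicator {z0 ^ k * R<..} (Y \<omega>) \<partial>M)"
    by (rule nn_integral_suminf) simp
  also have "\<dots> = (\<Sum>k. ennreal (c k) * emeasure M {\<omega>\<in>space M. z0 ^ k * R < Y \<omega>})"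
  proof (intro arg_cong[where f=suminf] ext)
    fix k
    have "(\<integral>\<^sup>+\<omega>. ennreal (c k) * indicator {z0 ^ k * R<..} (Y \<omega>) \<partial>M)
        = (\<integral>\<^sup>+\<omega>. ennreal (c k) * indicator {\<omega>\<in>space M. z0 ^ k * R < Y \<omega>} \<omega> \<partial>M)"
      by (intro nn_integral_cong) (auto simp: indicator_def)
    thus "(\<integral>\<^sup>+\<omega>. ennreal (c k) * indicator {z0 ^ k * R<..} (Y \<omega>) \<partial>M)
        = ennreal (c k) * emeasure M {\<omega>\<in>space M. z0 ^ k * R < Y \<omega>}"
      by (simp add: nn_integral_cmult_indicator)
  qed
  also have "\<dots> = (\<Sum>k. ennreal (c k * P (z0 ^ k * R)))"
    by (intro arg_cong[where f=suminf] ext) (simp add: P_def emeasure_eq_measure ennreal_mult c_def)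
  also have "\<dots> \<le> (\<Sum>k. ennreal ((z0 powr s * R powr s * max 1 C) * P R * q ^ k))"
    by (intro suminf_le ennreal_leI) (use term_le in \<open>auto simp: mult_ac\<close>)
  also have "\<dots> = ennreal ((z0 powr s * R powr s * max 1 C) * P R * (1 / (1 - q)))"
    by (intro suminf_ennreal_eq sums_mult geometric_sums) (use q in \<open>auto simp: P_def\<close>)
  also have "\<dots> = ennreal (z0 powr s * max 1 C / (1 - q) * R powr s) * ennreal (P R)"
    using q by (subst ennreal_mult[symmetric]) (auto simp: P_def mult_ac)
  finally show ?thesis by (simp add: q_def P_def emeasure_eq_measure)
qed

section \<open>Growth of supercritical moments\<close>

context affine_iid
begin

sublocale paths_pair: pair_sigma_finite paths paths
  by unfold_locales

text \<open>The integral is bounded below by a continuous function of the two unit vectors that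
  vanishes nowhere. Compactness of the product of spheres makes its minimum positive.\<close>

lemma nondegenerate_uniform:
  fixes s :: real
  assumes s: "0 < s"
    and nondeg: "\<And>x y. x \<noteq> 0 \<Longrightarrow> y \<noteq> 0 \<Longrightarrow>
      measure paths {\<omega>\<in>space paths. x \<bullet> (product n \<omega> *v y) = 0} < 1"
  obtains \<delta> where "0 < \<delta>" "\<And>x y. norm x = 1 \<Longrightarrow> norm y = 1 \<Longrightarrow>
      ennreal \<delta> \<le> (\<integral>\<^sup>+\<omega>. ennreal (\<bar>x \<bullet> (product n \<omega> *v y)\<bar> powr s) \<partial>paths)"
proof -
  \<comment> \<open>Cutting at 1 supplies a constant dominating function for the continuity
    argument, and it can only lower the integral.\<close>
  define g where "g z \<omega> = min 1 (\<bar>fst z \<bullet> (product n \<omega> *v snd z)\<bar> powr s)"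
    for z :: "(real^'d) \<times> (real^'d)" and \<omega>
  have [measurable]: "g z \<in> borel_measurable paths" for z unfolding g_def by measurable
  have g01: "0 \<le> g z \<omega>" "g z \<omega> \<le> 1" for z \<omega> by (auto simp: g_def)
  have int: "integrable paths (g z)" for z
    by (rule seq.P.integrable_const_bound[of _ 1]) (use g01 in auto)
  define K :: "((real^'d) \<times> (real^'d)) set" where "K = sphere 0 1 \<times> sphere 0 1"
  have "compact K" unfolding K_def by (intro compact_Times compact_sphere)
  obtain e :: "real^'d" where "norm e = 1" using norm_axis_1 by blast
  hence "(e, e) \<in> K" by (simp add: K_def)
  hence "K \<noteq> {}" by blast
  have cont: "continuous_on K (\<lambda>z. \<integral>\<omega>. g z \<omega> \<partial>paths)"
  proof (rule continuous_on_sequentiallyI)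
    fix u :: "nat \<Rightarrow> (real^'d) \<times> (real^'d)" and a
    assume u: "u \<longlonglongrightarrow> a"
    show "(\<lambda>i. \<integral>\<omega>. g (u i) \<omega> \<partial>paths) \<longlonglongrightarrow> (\<integral>\<omega>. g a \<omega> \<partial>paths)"
    proof (rule integral_dominated_convergence[where w="\<lambda>_. 1"])
      have "(\<lambda>i. g (u i) \<omega>) \<longlonglongrightarrow> g a \<omega>" for \<omega>
      proof -
        have "(\<lambda>i. product n \<omega> *v snd (u i)) \<longlonglongrightarrow> product n \<omega> *v snd a"
          by (rule bounded_linear.tendsto[OF matrix_vector_mul_bounded_linear tendsto_snd[OF u]])
        hence "(\<lambda>i. \<bar>fst (u i) \<bullet> (product n \<omega> *v snd (u i))\<bar>) \<longlonglongrightarrow> \<bar>fst a \<bullet> (product n \<omega> *v snd a)\<bar>"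
          by (intro tendsto_intros tendsto_fst[OF u])
        hence "(\<lambda>i. \<bar>fst (u i) \<bullet> (product n \<omega> *v snd (u i))\<bar> powr s) \<longlonglongrightarrow> \<bar>fst a \<bullet> (product n \<omega> *v snd a)\<bar> powr s"
          by (rule tendsto_powr'[OF _ tendsto_const]) (use s in auto)
        thus ?thesis unfolding g_def by (intro tendsto_min tendsto_const)
      qed
      thus "AE \<omega> in paths. (\<lambda>i. g (u i) \<omega>) \<longlonglongrightarrow> g a \<omega>" by simp
    qed (use g01 in auto)
  qed
  from continuous_attains_inf[OF \<open>compact K\<close> \<open>K \<noteq> {}\<close> cont]
  obtain z where z: "z \<in> K" "\<And>w. w \<in> K \<Longrightarrow> (\<integral>\<omega>. g z \<omega> \<partial>paths) \<le> (\<integral>\<omega>. g w \<omega> \<partial>paths)"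
    by blast
  define \<delta> where "\<delta> = (\<integral>\<omega>. g z \<omega> \<partial>paths)"
  have "\<delta> \<noteq> 0"
  proof
    assume "\<delta> = 0"
    hence "AE \<omega> in paths. g z \<omega> = 0"
      using integral_nonneg_eq_0_iff_AE[OF int[of z]] g01 by (auto simp: \<delta>_def)
    hence "AE \<omega> in paths. fst z \<bullet> (product n \<omega> *v snd z) = 0"
      by eventually_elim (auto simp: g_def min_def split: if_splits)
    hence "measure paths {\<omega>\<in>space paths. fst z \<bullet> (product n \<omega> *v snd z) = 0} = 1"
      by (subst seq.P.prob_Collect_eq_1) auto
    moreover have "fst z \<noteq> 0" "snd z \<noteq> 0" using z(1) by (auto simp: K_def)
    ultimately show False using nondeg[of "fst z" "snd z"] by simp
  qed
  moreover have "0 \<le> \<delta>" unfolding \<delta>_def using g01 by (intro integral_nonneg_AE) auto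
  ultimately have "0 < \<delta>" by simp
  moreover have "ennreal \<delta> \<le> (\<integral>\<^sup>+\<omega>. ennreal (\<bar>x \<bullet> (product n \<omega> *v y)\<bar> powr s) \<partial>paths)"
    if "norm x = 1" "norm y = 1" for x y
  proof -
    have "ennreal \<delta> \<le> ennreal (\<integral>\<omega>. g (x, y) \<omega> \<partial>paths)"
      unfolding \<delta>_def by (intro ennreal_leI z) (use that in \<open>simp add: K_def\<close>)
    also have "\<dots> = (\<integral>\<^sup>+\<omega>. ennreal (g (x, y) \<omega>) \<partial>paths)"
      by (rule nn_integral_eq_integral[symmetric]) (use int g01 in auto)
    also have "\<dots> \<le> (\<integral>\<^sup>+\<omega>. ennreal (\<bar>x \<bullet> (product n \<omega> *v y)\<bar> powr s) \<partial>paths)"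
      by (intro nn_integral_mono ennreal_leI) (simp add: g_def)
    finally show ?thesis .
  qed
  ultimately show ?thesis using that by blast
qed

text \<open>Freeze the later matrices as Q and take a row of Q carrying its norm. That row is
  independent of the first \<open>n\<^sub>0\<close> factors, so the uniform nondegeneracy applies to
  the row and y. The resulting constant does not depend on n.\<close>

lemma mom_le_directional:
  fixes s :: real
  assumes s: "0 < s"
    and nondeg: "\<And>x y. x \<noteq> 0 \<Longrightarrow> y \<noteq> 0 \<Longrightarrow>
      measure paths {\<omega>\<in>space paths. x \<bullet> (product n\<^sub>0 \<omega> *v y) = 0} < 1"
  obtains \<delta> where "0 < \<delta>" "\<And>n y. ennreal (\<delta> * norm y powr s) * mom s n
      \<le> (\<integral>\<^sup>+\<omega>. ennreal (norm (product (n\<^sub>0 + n) \<omega> *v y) powr s) \<partial>paths)"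
proof -
  obtain \<delta> where \<delta>: "0 < \<delta>" "\<And>x y. norm x = 1 \<Longrightarrow> norm y = 1 \<Longrightarrow>
      ennreal \<delta> \<le> (\<integral>\<^sup>+\<omega>. ennreal (\<bar>x \<bullet> (product n\<^sub>0 \<omega> *v y)\<bar> powr s) \<partial>paths)"
    using nondegenerate_uniform[OF s nondeg] by blast
  have scaled: "ennreal (\<delta> * norm x powr s * norm y powr s)
      \<le> (\<integral>\<^sup>+\<omega>. ennreal (\<bar>x \<bullet> (product n\<^sub>0 \<omega> *v y)\<bar> powr s) \<partial>paths)" for x y
  proof (cases "x = 0 \<or> y = 0")
    case False
    define c where "c = norm x powr s * norm y powr s"
    have c: "0 \<le> c" by (simp add: c_def)
    have "ennreal c * ennreal \<delta> \<le> ennreal c * (\<integral>\<^sup>+\<omega>. ennreal (\<bar>(x /\<^sub>R norm x) \<bullet> (product n\<^sub>0 \<omega> *v (y /\<^sub>R norm y))\<bar> powr s) \<partial>paths)"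
      by (intro mult_left_mono \<delta>(2)) (use False in auto)
    also have "\<dots> = (\<integral>\<^sup>+\<omega>. ennreal c * ennreal (\<bar>(x /\<^sub>R norm x) \<bullet> (product n\<^sub>0 \<omega> *v (y /\<^sub>R norm y))\<bar> powr s) \<partial>paths)"
      by (rule nn_integral_cmult[symmetric]) simp
    also have "\<dots> = (\<integral>\<^sup>+\<omega>. ennreal (\<bar>x \<bullet> (product n\<^sub>0 \<omega> *v y)\<bar> powr s) \<partial>paths)"
    proof (intro nn_integral_cong)
      fix \<omega>
      have "c * \<bar>(x /\<^sub>R norm x) \<bullet> (product n\<^sub>0 \<omega> *v (y /\<^sub>R norm y))\<bar> powr s
          = (norm x * norm y * \<bar>(x /\<^sub>R norm x) \<bullet> (product n\<^sub>0 \<omega> *v (y /\<^sub>R norm y))\<bar>) powr s"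
        by (simp add: c_def powr_mult)
      also have "norm x * norm y * \<bar>(x /\<^sub>R norm x) \<bullet> (product n\<^sub>0 \<omega> *v (y /\<^sub>R norm y))\<bar>
          = \<bar>x \<bullet> (product n\<^sub>0 \<omega> *v y)\<bar>"
        using False by (simp add: matrix_vector_mult_scaleR abs_mult field_simps)
      finally show "ennreal c * ennreal (\<bar>(x /\<^sub>R norm x) \<bullet> (product n\<^sub>0 \<omega> *v (y /\<^sub>R norm y))\<bar> powr s)
          = ennreal (\<bar>x \<bullet> (product n\<^sub>0 \<omega> *v y)\<bar> powr s)"
        using c by (simp add: ennreal_mult[symmetric])
    qed
    finally show ?thesis using c \<delta>(1) by (simp add: ennreal_mult[symmetric] c_def mult_ac)
  qed auto
  \<comment> \<open>The division undoes the factor d lost in passing from the norm of Q to one of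
    its rows.\<close>
  define \<delta>' where "\<delta>' = \<delta> / real CARD('d) powr s"
  have d: "0 < real CARD('d)" by simp
  have matrix: "ennreal (\<delta>' * norm y powr s) * ennreal (opnorm Q powr s)
      \<le> (\<integral>\<^sup>+\<omega>. ennreal (norm (Q *v (product n\<^sub>0 \<omega> *v y)) powr s) \<partial>paths)" for Q :: "real^'d^'d" and y
  proof -
    obtain i where i: "opnorm Q \<le> real CARD('d) * norm (Q $ i)" by (rule opnorm_le_row)
    have "opnorm Q powr s \<le> (real CARD('d) * norm (Q $ i)) powr s"
      by (intro powr_mono2) (use s i opnorm_nonneg in auto)
    also have "\<dots> = real CARD('d) powr s * norm (Q $ i) powr s" by (simp add: powr_mult)
    finally have "\<delta>' * norm y powr s * opnorm Q powr s
        \<le> \<delta>' * norm y powr s * (real CARD('d) powr s * norm (Q $ i) powr s)"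
      by (intro mult_left_mono) (use \<delta> in \<open>auto simp: \<delta>'_def\<close>)
    also have "\<dots> = \<delta> * norm (Q $ i) powr s * norm y powr s"
      using d by (simp add: \<delta>'_def)
    finally have "ennreal (\<delta>' * norm y powr s) * ennreal (opnorm Q powr s)
        \<le> ennreal (\<delta> * norm (Q $ i) powr s * norm y powr s)"
      using \<delta>(1) by (simp add: ennreal_mult[symmetric] \<delta>'_def ennreal_leI)
    also have "\<dots> \<le> (\<integral>\<^sup>+\<omega>. ennreal (\<bar>(Q $ i) \<bullet> (product n\<^sub>0 \<omega> *v y)\<bar> powr s) \<partial>paths)"
      by (rule scaled)
    also have "\<dots> \<le> (\<integral>\<^sup>+\<omega>. ennreal (norm (Q *v (product n\<^sub>0 \<omega> *v y)) powr s) \<partial>paths)"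
    proof (intro nn_integral_mono ennreal_leI powr_mono2)
      fix \<omega>
      show "\<bar>(Q $ i) \<bullet> (product n\<^sub>0 \<omega> *v y)\<bar> \<le> norm (Q *v (product n\<^sub>0 \<omega> *v y))"
        using component_le_norm_cart[of "Q *v (product n\<^sub>0 \<omega> *v y)" i]
        by (simp only: matrix_vector_mul_component)
    qed (use s in auto)
    finally show ?thesis .
  qed
  have "ennreal (\<delta>' * norm y powr s) * mom s n
      \<le> (\<integral>\<^sup>+\<omega>. ennreal (norm (product (n\<^sub>0 + n) \<omega> *v y) powr s) \<partial>paths)" for n y
  proof -
    have "ennreal (\<delta>' * norm y powr s) * mom s n
        = (\<integral>\<^sup>+\<omega>'. ennreal (\<delta>' * norm y powr s) * ennreal (opnorm (product n \<omega>') powr s) \<partial>paths)"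
      unfolding mom_def norm_moment_def by (rule nn_integral_cmult[symmetric]) simp
    also have "\<dots> \<le> (\<integral>\<^sup>+\<omega>'. \<integral>\<^sup>+\<omega>. ennreal (norm (product n \<omega>' *v (product n\<^sub>0 \<omega> *v y)) powr s) \<partial>paths \<partial>paths)"
      by (intro nn_integral_mono matrix)
    \<comment> \<open>The row is chosen from the later matrices, whereas gluing integrates over the
      earlier ones on the outside; hence the exchange.\<close>
    also have "\<dots> = (\<integral>\<^sup>+\<omega>. \<integral>\<^sup>+\<omega>'. ennreal (norm (product n \<omega>' *v (product n\<^sub>0 \<omega> *v y)) powr s) \<partial>paths \<partial>paths)"
      by (rule paths_pair.Fubini') simp
    also have "\<dots> = (\<integral>\<^sup>+\<omega>. ennreal (norm (product (n\<^sub>0 + n) \<omega> *v y) powr s) \<partial>paths)"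
      by (subst (3) nn_integral_comb_seq[of _ n\<^sub>0]) (auto simp: product_comb_seq matrix_vector_mul_assoc)
    finally show ?thesis .
  qed
  moreover have "0 < \<delta>'" using \<delta>(1) d by (simp add: \<delta>'_def)
  ultimately show ?thesis using that by blast
qed

lemma product_moment_le:
  assumes s: "0 < s"
  shows "(\<integral>\<^sup>+\<omega>. ennreal (norm (product n \<omega> *v x) powr s) \<partial>paths)
    \<le> ennreal (2 powr s) * (emom s n x + emom s n 0)"
proof -
  have "(\<integral>\<^sup>+\<omega>. ennreal (norm (product n \<omega> *v x) powr s) \<partial>paths)
      \<le> (\<integral>\<^sup>+\<omega>. ennreal (2 powr s) * (ennreal (norm (process x n \<omega>) powr s) + ennreal (norm (process 0 n \<omega>) powr s)) \<partial>paths)"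
  proof (intro nn_integral_mono)
    fix \<omega>
    have "norm (product n \<omega> *v x) = norm (process x n \<omega> - process 0 n \<omega>)"
      by (subst process_affine) simp
    also have "\<dots> \<le> norm (process x n \<omega>) + norm (process 0 n \<omega>)" by (rule norm_triangle_ineq4)
    finally have "norm (product n \<omega> *v x) powr s \<le> (norm (process x n \<omega>) + norm (process 0 n \<omega>)) powr s"
      using s by (intro powr_mono2) auto
    also have "\<dots> \<le> 2 powr s * (norm (process x n \<omega>) powr s + norm (process 0 n \<omega>) powr s)"
      using s by (intro powr_add_le) auto
    finally show "ennreal (norm (product n \<omega> *v x) powr s)
        \<le> ennreal (2 powr s) * (ennreal (norm (process x n \<omega>) powr s) + ennreal (norm (process 0 n \<omega>) powr s))"
      by (simp add: ennreal_mult[symmetric] ennreal_plus[symmetric] ennreal_leI del: ennreal_plus)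
  qed
  also have "\<dots> = ennreal (2 powr s) * (emom s n x + emom s n 0)"
    by (simp add: nn_integral_cmult nn_integral_add emom_def)
  finally show ?thesis .
qed

text \<open>The linear part grows from every direction. Passing to the affine process costs only the
  moment of the path started at 0, which is absorbed into D.\<close>

lemma emom_block_growth:
  assumes r: "0 < r" "1 \<le> m" "mom r m < 1" and s: "r < a" "a < s"
    and a: "mom a 1 < \<infinity>" "h_moment paths coord_A a = 1"
    and fin: "mom s 1 < \<infinity>" "emom s 1 0 < \<infinity>"
    and n\<^sub>0: "1 \<le> n\<^sub>0" and nondeg: "\<And>x y. x \<noteq> 0 \<Longrightarrow> y \<noteq> 0 \<Longrightarrow>
      measure paths {\<omega>\<in>space paths. x \<bullet> (product n\<^sub>0 \<omega> *v y) = 0} < 1"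
  obtains N D where "1 \<le> N" "1 \<le> D" "\<And>x. ennreal (2 * norm x powr s) \<le> emom s N x + ennreal D"
proof -
  have s0: "0 < s" using r s by simp
  obtain \<delta> where \<delta>: "0 < \<delta>" "\<And>n y. ennreal (\<delta> * norm y powr s) * mom s n
      \<le> (\<integral>\<^sup>+\<omega>. ennreal (norm (product (n\<^sub>0 + n) \<omega> *v y) powr s) \<partial>paths)"
    using mom_le_directional[OF s0 nondeg] by blast
  \<comment> \<open>The leading 2 is the doubling to be achieved, \<open>2 powr s\<close> is lost in
    \<open>product_moment_le\<close>, and \<open>\<delta>\<close> in
    \<open>mom_le_directional\<close>.\<close>
  obtain k where k: "ennreal (2 * 2 powr s / \<delta>) \<le> mom s (k * m)"
    using mom_unbounded_above_critical[OF r s a] by blast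
  define N where "N = n\<^sub>0 + k * m"
  obtain D0 where D0: "emom s N 0 = ennreal D0" "0 \<le> D0"
    using emom_finite[OF s0 fin, of N 0] by (cases "emom s N 0") auto
  have "ennreal (2 * norm x powr s) \<le> emom s N x + ennreal (D0 + 1)" for x
  proof -
    have "ennreal (2 powr s) * ennreal (2 * norm x powr s)
        = ennreal (\<delta> * norm x powr s) * ennreal (2 * 2 powr s / \<delta>)"
      using \<delta>(1) by (simp add: ennreal_mult[symmetric] mult_ac)
    also have "\<dots> \<le> ennreal (\<delta> * norm x powr s) * mom s (k * m)"
      by (intro mult_left_mono k) simp
    also have "\<dots> \<le> ennreal (2 powr s) * (emom s N x + emom s N 0)"
      unfolding N_def by (rule order_trans[OF \<delta>(2) product_moment_le[OF s0]])
    finally have "ennreal (2 * norm x powr s) \<le> emom s N x + emom s N 0"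
      by (subst (asm) ennreal_mult_le_mult_iff) auto
    also have "\<dots> \<le> emom s N x + ennreal (D0 + 1)"
      unfolding D0 by (intro add_left_mono ennreal_leI) simp
    finally show ?thesis .
  qed
  with that[of N "D0 + 1"] n\<^sub>0 D0 show ?thesis by (simp add: N_def)
qed

text \<open>In real terms the moment after k blocks is at least
  \<open>2 ^ k * (norm x powr s - D)\<close>. This explodes only for starts outside a fixed ball, so
  starts inside it have to be moved out first.\<close>

lemma emom_iterated_growth:
  assumes growth: "\<And>x. ennreal (2 * norm x powr s) \<le> emom s N x + ennreal D" and D: "0 \<le> D"
  shows "ennreal (2 ^ k * norm x powr s) \<le> emom s (k * N) x + ennreal (2 ^ k * D)"
proof (induction k arbitrary: x)
  case 0
  show ?case using D by (simp add: add_increasing2)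
next
  case (Suc k)
  have "ennreal (2 ^ Suc k * norm x powr s) = ennreal (2 ^ k) * ennreal (2 * norm x powr s)"
    by (simp add: ennreal_mult[symmetric] mult_ac)
  also have "\<dots> \<le> ennreal (2 ^ k) * (emom s N x + ennreal D)"
    by (intro mult_left_mono growth) simp
  also have "\<dots> = ennreal (2 ^ k) * emom s N x + ennreal (2 ^ k * D)"
    using D by (simp add: distrib_left ennreal_mult)
  also have "ennreal (2 ^ k) * emom s N x = (\<integral>\<^sup>+\<omega>. ennreal (2 ^ k * norm (process x N \<omega>) powr s) \<partial>paths)"
    unfolding emom_def by (subst nn_integral_cmult[symmetric]) (auto simp: ennreal_mult)
  also have "\<dots> \<le> (\<integral>\<^sup>+\<omega>. emom s (k * N) (process x N \<omega>) + ennreal (2 ^ k * D) \<partial>paths)"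
    by (intro nn_integral_mono Suc)
  also have "\<dots> = emom s (Suc k * N) x + ennreal (2 ^ k * D)"
    by (simp add: nn_integral_add emom_add seq.P.emeasure_space_1)
  finally show ?case using D
    by (simp add: ennreal_plus[symmetric] add.assoc mult_ac del: ennreal_plus)
qed

end

section \<open>Large values are reached uniformly\<close>

context affine_iid
begin

lemma stationary_process:
  assumes \<nu>: "prob_space \<nu>" "sets \<nu> = sets borel"
      "distr (\<nu> \<Otimes>\<^sub>M \<mu>) borel (\<lambda>(x, p). fst p *v x + snd p) = \<nu>"
    and f [measurable]: "f \<in> borel_measurable borel"
  shows "(\<integral>\<^sup>+x. \<integral>\<^sup>+\<omega>. f (process x n \<omega>) \<partial>paths \<partial>\<nu>) = (\<integral>\<^sup>+x. f x \<partial>\<nu>)"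
proof (induction n)
  case 0
  show ?case by (simp add: seq.P.emeasure_space_1)
next
  case (Suc n)
  note [measurable_cong] = \<nu>(2)
  define g where "g y = (\<integral>\<^sup>+\<omega>. f (process y n \<omega>) \<partial>paths)" for y
  have [measurable]: "g \<in> borel_measurable borel" unfolding g_def by measurable
  have "(\<integral>\<^sup>+x. \<integral>\<^sup>+\<omega>. f (process x (Suc n) \<omega>) \<partial>paths \<partial>\<nu>) = (\<integral>\<^sup>+x. \<integral>\<^sup>+p. g (fst p *v x + snd p) \<partial>\<mu> \<partial>\<nu>)"
    using nn_integral_process_add[OF f, of _ 1 n] nn_integral_process_1[of g] by (simp add: g_def)
  also have "\<dots> = (\<integral>\<^sup>+z. g (fst (snd z) *v fst z + snd (snd z)) \<partial>(\<nu> \<Otimes>\<^sub>M \<mu>))"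
    by (subst nn_integral_fst[symmetric]) auto
  also have "\<dots> = (\<integral>\<^sup>+x. g x \<partial>distr (\<nu> \<Otimes>\<^sub>M \<mu>) borel (\<lambda>(x, p). fst p *v x + snd p))"
    by (subst nn_integral_distr) (auto simp: split_beta')
  also have "\<dots> = (\<integral>\<^sup>+x. f x \<partial>\<nu>)" unfolding \<nu>(3) g_def by (rule Suc)
  finally show ?case .
qed

lemma emeasure_product_norm_ge_le:
  assumes "0 < r" "0 < W"
  shows "emeasure paths {\<omega>\<in>space paths. 1 \<le> opnorm (product n \<omega>) * W} \<le> ennreal (W powr r) * mom r n"
proof -
  have "emeasure paths {\<omega>\<in>space paths. 1 \<le> opnorm (product n \<omega>) * W}
      = (\<integral>\<^sup>+\<omega>. indicator {\<omega>\<in>space paths. 1 \<le> opnorm (product n \<omega>) * W} \<omega> \<partial>paths)"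
    by (rule nn_integral_indicator[symmetric]) simp
  also have "\<dots> \<le> (\<integral>\<^sup>+\<omega>. ennreal (W powr r) * ennreal (opnorm (product n \<omega>) powr r) \<partial>paths)"
  proof (intro nn_integral_mono)
    fix \<omega>
    show "indicator {\<omega>\<in>space paths. 1 \<le> opnorm (product n \<omega>) * W} \<omega>
        \<le> ennreal (W powr r) * ennreal (opnorm (product n \<omega>) powr r)"
    proof (cases "1 \<le> opnorm (product n \<omega>) * W")
      case True
      hence "1 \<le> W powr r * opnorm (product n \<omega>) powr r"
        using powr_mono2[of r 1 "opnorm (product n \<omega>) * W"] assms by (simp add: powr_mult mult.commute)
      thus ?thesis by (simp add: ennreal_mult[symmetric] indicator_def)
    qed simp
  qed
  also have "\<dots> = ennreal (W powr r) * mom r n"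
    by (simp add: nn_integral_cmult mom_def norm_moment_def)
  finally show ?thesis .
qed

text \<open>Coupling: a start x in the ball and a stationary start y use the same noise, so after n
  steps they differ by at most the norm of the product times |y - x|. The stationary path is far out
  with probability q; discarding large y and a large product costs q/4 each, which leaves q/2 for
  the path from x.\<close>

lemma reach_large_values:
  assumes \<nu>: "prob_space \<nu>" "sets \<nu> = sets borel"
      "distr (\<nu> \<Otimes>\<^sub>M \<mu>) borel (\<lambda>(x, p). fst p *v x + snd p) = \<nu>"
    and tail: "\<And>L. 0 < measure \<nu> {x. L < norm x}"
    and r: "0 < r" "mom r m < 1" and N: "1 \<le> N"
  obtains j p where "0 < p" "\<And>x. norm x \<le> L \<Longrightarrow>
    ennreal p \<le> emeasure paths {\<omega>\<in>space paths. L < norm (process x (j * N) \<omega>)}"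
proof -
  interpret nu: prob_space \<nu> by fact
  note [measurable_cong] = \<nu>(2)
  have space_nu: "space \<nu> = UNIV" using sets_eq_imp_space_eq[OF \<nu>(2)] by simp
  \<comment> \<open>Level L + 1 instead of L leaves room for the distance, less than 1, between the
    coupled paths.\<close>
  define q where "q = measure \<nu> {x. L + 1 < norm x}"
  have q: "0 < q" unfolding q_def by (rule tail)
  have "(\<lambda>i. measure \<nu> {x. real i < norm x}) \<longlonglongrightarrow> measure \<nu> (\<Inter>i. {x. real i < norm x})"
    by (rule nu.finite_Lim_measure_decseq) (auto simp: decseq_def)
  also have "(\<Inter>i. {x :: real^'d. real i < norm x}) = {}"
    by auto (metis reals_Archimedean2 less_asym)
  finally have "\<forall>\<^sub>F i in sequentially. measure \<nu> {x. real i < norm x} < q / 4"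
    by (rule order_tendstoD) (use q in simp)
  then obtain i where i: "measure \<nu> {x. real i < norm x} < q / 4"
    by (auto simp: eventually_sequentially)
  \<comment> \<open>W bounds |y - x| when |x| is at most L and |y| at most i.\<close>
  define W where "W = \<bar>L\<bar> + real i + 1"
  have W: "0 < W" by (simp add: W_def)
  obtain \<rho> where \<rho>: "0 < \<rho>" "\<rho> < 1" "\<And>k. mom r (k * m) \<le> ennreal (\<rho> ^ k)"
    using mom_le_geometric[of r m] r by auto
  have "(\<lambda>k. W powr r * \<rho> ^ k) \<longlonglongrightarrow> W powr r * 0"
    by (intro tendsto_intros LIMSEQ_power_zero) (use \<rho> in auto)
  hence "\<forall>\<^sub>F k in sequentially. W powr r * \<rho> ^ k < q / 4"
    by (rule order_tendstoD) (use q in simp)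
  then obtain k where k: "W powr r * \<rho> ^ k < q / 4"
    by (auto simp: eventually_sequentially)
  \<comment> \<open>A multiple of m so that the moment of the product decays, and a multiple of N so
    that it fits the blocks of the growth estimate.\<close>
  define n where "n = k * m * N"
  define bad where "bad = {\<omega>\<in>space paths. 1 \<le> opnorm (product n \<omega>) * W}"
  have "mom r n \<le> ennreal (\<rho> ^ (k * N))" using \<rho>(3)[of "k * N"] by (simp add: n_def mult_ac)
  also have "\<dots> \<le> ennreal (\<rho> ^ k)" using \<rho> N by (intro ennreal_leI power_decreasing) auto
  finally have "ennreal (W powr r) * mom r n \<le> ennreal (W powr r) * ennreal (\<rho> ^ k)"
    by (rule mult_left_mono) simp
  also have "\<dots> \<le> ennreal (q / 4)"
    using k \<rho> by (simp add: ennreal_mult[symmetric] ennreal_leI)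
  finally have "ennreal (W powr r) * mom r n \<le> ennreal (q / 4)" .
  hence bad: "emeasure paths bad \<le> ennreal (q / 4)"
    using emeasure_product_norm_ge_le[OF r(1) W, of n] unfolding bad_def by (rule order_trans[rotated])
  have "ennreal (q / 2) \<le> emeasure paths {\<omega>\<in>space paths. L < norm (process x n \<omega>)}" if x: "norm x \<le> L" for x
  proof -
    define P where "P = measure paths {\<omega>\<in>space paths. L < norm (process x n \<omega>)}"
    have pointwise: "emeasure paths {\<omega>\<in>space paths. L + 1 < norm (process y n \<omega>)}
        \<le> indicator {x. real i < norm x} y + (ennreal P + ennreal (q / 4))" for y
    proof (cases "real i < norm y")
      case True
      have "emeasure paths {\<omega>\<in>space paths. L + 1 < norm (process y n \<omega>)} \<le> 1"
        by (rule seq.P.measure_le_1)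
      thus ?thesis using True by (simp add: add_increasing2)
    next
      case False
      have "{\<omega>\<in>space paths. L + 1 < norm (process y n \<omega>)}
          \<subseteq> {\<omega>\<in>space paths. L < norm (process x n \<omega>)} \<union> bad"
      proof (rule subsetI, rule ccontr)
        fix \<omega> assume *: "\<omega> \<in> {\<omega>\<in>space paths. L + 1 < norm (process y n \<omega>)}"
          "\<omega> \<notin> {\<omega>\<in>space paths. L < norm (process x n \<omega>)} \<union> bad"
        have "norm (process y n \<omega> - process x n \<omega>) = norm (product n \<omega> *v (y - x))"
          by (subst (1 2) process_affine) (simp add: matrix_vector_mult_diff_distrib)
        also have "\<dots> \<le> opnorm (product n \<omega>) * norm (y - x)" by (rule norm_matrix_vector_le)
        also have "\<dots> \<le> opnorm (product n \<omega>) * W"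
          using norm_triangle_ineq4[of y x] False x
          by (intro mult_left_mono opnorm_nonneg) (auto simp: W_def)
        also have "\<dots> < 1" using * by (auto simp: bad_def)
        finally have "norm (process y n \<omega> - process x n \<omega>) < 1" .
        with norm_triangle_sub[of "process y n \<omega>" "process x n \<omega>"] * show False by auto
      qed
      hence "emeasure paths {\<omega>\<in>space paths. L + 1 < norm (process y n \<omega>)}
          \<le> emeasure paths ({\<omega>\<in>space paths. L < norm (process x n \<omega>)} \<union> bad)"
        by (rule emeasure_mono) (simp add: bad_def)
      also have "\<dots> \<le> emeasure paths {\<omega>\<in>space paths. L < norm (process x n \<omega>)} + emeasure paths bad"
        by (rule emeasure_subadditive) (auto simp: bad_def)
      also have "\<dots> \<le> ennreal P + ennreal (q / 4)"
        by (intro add_mono bad) (simp add: P_def seq.P.emeasure_eq_measure)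
      finally show ?thesis by (simp add: add_increasing)
    qed
    have "ennreal q = (\<integral>\<^sup>+y. indicator {x. L + 1 < norm x} y \<partial>\<nu>)"
      by (simp add: q_def nu.emeasure_eq_measure)
    also have "\<dots> = (\<integral>\<^sup>+y. \<integral>\<^sup>+\<omega>. indicator {x. L + 1 < norm x} (process y n \<omega>) \<partial>paths \<partial>\<nu>)"
      by (rule stationary_process[OF \<nu>, symmetric]) simp
    also have "\<dots> = (\<integral>\<^sup>+y. emeasure paths {\<omega>\<in>space paths. L + 1 < norm (process y n \<omega>)} \<partial>\<nu>)"
    proof (intro nn_integral_cong)
      fix y
      have "(\<integral>\<^sup>+\<omega>. indicator {x. L + 1 < norm x} (process y n \<omega>) \<partial>paths)
          = (\<integral>\<^sup>+\<omega>. indicator {\<omega>\<in>space paths. L + 1 < norm (process y n \<omega>)} \<omega> \<partial>paths)"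
        by (rule nn_integral_cong) (simp add: indicator_def)
      also have "\<dots> = emeasure paths {\<omega>\<in>space paths. L + 1 < norm (process y n \<omega>)}"
        by (rule nn_integral_indicator) simp
      finally show "(\<integral>\<^sup>+\<omega>. indicator {x. L + 1 < norm x} (process y n \<omega>) \<partial>paths)
          = emeasure paths {\<omega>\<in>space paths. L + 1 < norm (process y n \<omega>)}" .
    qed
    also have "\<dots> \<le> (\<integral>\<^sup>+y. indicator {x. real i < norm x} y + (ennreal P + ennreal (q / 4)) \<partial>\<nu>)"
      by (intro nn_integral_mono pointwise)
    also have "\<dots> = ennreal (measure \<nu> {x. real i < norm x}) + (ennreal P + ennreal (q / 4))"
      by (subst nn_integral_add) (auto simp: nu.emeasure_eq_measure nu.prob_space nu.emeasure_space_1)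
    also have "\<dots> = ennreal (measure \<nu> {x. real i < norm x} + (P + q / 4))"
      using q by (simp add: P_def)
    finally have "q \<le> measure \<nu> {x. real i < norm x} + (P + q / 4)"
      using q by (subst (asm) ennreal_le_iff) (auto simp: P_def)
    hence "q / 2 \<le> P" using i by simp
    thus ?thesis by (simp add: P_def seq.P.emeasure_eq_measure ennreal_leI)
  qed
  with that[of "q / 2" "k * m"] q show ?thesis by (simp add: n_def)
qed

text \<open>Starts outside radius L grow at once. From inside, the process is outside after j blocks
  with probability at least p, and k further doublings outweigh the small p. One common time works
  for both cases.\<close>

lemma emom_increment:
  assumes growth: "1 \<le> N" "1 \<le> D" "\<And>x. ennreal (2 * norm x powr s) \<le> emom s N x + ennreal D"
    and s: "0 < s"
    and reach: "\<And>L. \<exists>j p. 0 < p \<and> (\<forall>x. norm x \<le> L \<longrightarrow>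
      ennreal p \<le> emeasure paths {\<omega>\<in>space paths. L < norm (process x (j * N) \<omega>)})"
  obtains n where "\<And>x. ennreal (norm x powr s + 1) \<le> emom s n x"
proof -
  \<comment> \<open>Beyond this radius \<open>norm x powr s - D\<close> is at least 1, and twice it
    is at least \<open>norm x powr s + 1\<close>.\<close>
  define L where "L = (2 * D + 2) powr (1 / s)"
  have Ls: "L powr s = 2 * D + 2" using s growth by (simp add: L_def powr_powr)
  have L0: "0 \<le> L" by (simp add: L_def)
  obtain j p where p: "0 < p" and jp: "\<And>x. norm x \<le> L \<Longrightarrow>
      ennreal p \<le> emeasure paths {\<omega>\<in>space paths. L < norm (process x (j * N) \<omega>)}"
    using reach[of L] by blast
  \<comment> \<open>\<open>2 * D + 3\<close> is \<open>L powr s + 1\<close>, the most that a start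
    inside the ball has to reach. The later \<open>Suc\<close> guarantees one doubling for starts
    outside.\<close>
  obtain k0 where k0: "(2 * D + 3) / p < 2 ^ k0"
    using real_arch_pow[of 2 "(2 * D + 3) / p"] by auto
  define k where "k = Suc k0"
  have k: "2 * D + 3 \<le> p * 2 ^ k"
  proof -
    have "2 * D + 3 < 2 ^ k0 * p" using k0 p by (simp add: pos_divide_less_eq)
    also have "\<dots> \<le> 2 ^ k * p" using p by (intro mult_right_mono) (auto simp: k_def)
    finally show ?thesis by (simp add: mult.commute)
  qed
  \<comment> \<open>For \<open>norm x powr s\<close> below D the left side is truncated to 0 by
    \<open>ennreal\<close>, so no case distinction on x is needed.\<close>
  have iterated: "ennreal (2 ^ i * (norm x powr s - D)) \<le> emom s (i * N) x" for i x
  proof (cases "emom s (i * N) x")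
    case (real v)
    have "ennreal (2 ^ i * norm x powr s) \<le> ennreal (v + 2 ^ i * D)"
      using emom_iterated_growth[OF growth(3), of i x] growth(2) real by simp
    hence "2 ^ i * norm x powr s \<le> v + 2 ^ i * D"
      using real growth(2) by (subst (asm) ennreal_le_iff) auto
    thus ?thesis using real by (auto intro!: ennreal_leI simp: algebra_simps)
  qed simp
  have large: "2 * D + 2 \<le> norm x powr s" if "L < norm x" for x :: "real^'d"
    using powr_mono2[of s L "norm x"] that Ls L0 s by simp
  have "ennreal (norm x powr s + 1) \<le> emom s ((j + k) * N) x" for x
  proof (cases "L < norm x")
    case True
    have "(2::real) ^ 1 \<le> 2 ^ (j + k)" by (intro power_increasing) (auto simp: k_def)
    hence "2 * (norm x powr s - D) \<le> 2 ^ (j + k) * (norm x powr s - D)"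
      by (intro mult_right_mono) (use large[OF True] growth(2) in auto)
    moreover have "norm x powr s + 1 \<le> 2 * (norm x powr s - D)"
      using large[OF True] by (simp add: algebra_simps)
    ultimately have "norm x powr s + 1 \<le> 2 ^ (j + k) * (norm x powr s - D)" by simp
    hence "ennreal (norm x powr s + 1) \<le> ennreal (2 ^ (j + k) * (norm x powr s - D))"
      by (rule ennreal_leI)
    also note iterated
    finally show ?thesis .
  next
    case False
    have "norm x powr s \<le> 2 * D + 2" using powr_mono2[of s "norm x" L] False Ls s by simp
    hence "ennreal (norm x powr s + 1) \<le> ennreal (2 ^ k * p)"
      by (intro ennreal_leI) (use k in \<open>simp add: mult.commute\<close>)
    also have "\<dots> \<le> ennreal (2 ^ k) * emeasure paths {\<omega>\<in>space paths. L < norm (process x (j * N) \<omega>)}"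
      using jp[of x] False p by (simp add: ennreal_mult mult_left_mono)
    also have "\<dots> = (\<integral>\<^sup>+\<omega>. ennreal (2 ^ k) * indicator {\<omega>\<in>space paths. L < norm (process x (j * N) \<omega>)} \<omega> \<partial>paths)"
      by (rule nn_integral_cmult_indicator[symmetric]) simp
    also have "\<dots> \<le> (\<integral>\<^sup>+\<omega>. emom s (k * N) (process x (j * N) \<omega>) \<partial>paths)"
    proof (intro nn_integral_mono)
      fix \<omega>
      define y where "y = process x (j * N) \<omega>"
      have "ennreal (2 ^ k) \<le> emom s (k * N) y" if y: "L < norm y"
      proof -
        have "2 ^ k * 1 \<le> 2 ^ k * (norm y powr s - D)"
          by (intro mult_left_mono) (use large[OF y] growth(2) in auto)
        hence "ennreal (2 ^ k) \<le> ennreal (2 ^ k * (norm y powr s - D))" by (intro ennreal_leI) simp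
        also note iterated
        finally show ?thesis .
      qed
      thus "ennreal (2 ^ k) * indicator {\<omega>\<in>space paths. L < norm (process x (j * N) \<omega>)} \<omega>
          \<le> emom s (k * N) (process x (j * N) \<omega>)"
        by (auto simp: y_def indicator_def)
    qed
    also have "\<dots> = emom s ((j + k) * N) x"
      by (simp add: emom_add[symmetric] distrib_right)
    finally show ?thesis .
  qed
  thus ?thesis using that by blast
qed

end

section \<open>The mean exit time\<close>

lemma less_Inf_enat_iff: "enat k < Inf (enat ` S) \<longleftrightarrow> (\<forall>j\<le>k. j \<notin> S)"
proof
  assume *: "enat k < Inf (enat ` S)"
  show "\<forall>j\<le>k. j \<notin> S"
  proof (intro allI impI notI)
    fix j assume "j \<le> k" "j \<in> S"
    hence "Inf (enat ` S) \<le> enat k" by (meson Inf_lower2 enat_ord_simps(1) imageI)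
    with * show False by simp
  qed
next
  assume "\<forall>j\<le>k. j \<notin> S"
  hence "enat (Suc k) \<le> Inf (enat ` S)"
    by (intro Inf_greatest) (auto simp: not_less_eq_eq[symmetric])
  thus "enat k < Inf (enat ` S)" by (simp add: Suc_ile_eq)
qed

lemma ennreal_of_enat_eq_suminf: "ennreal_of_enat T = (\<Sum>k. if enat k < T then 1 else 0)"
proof (cases T)
  case (enat n)
  have "(\<Sum>k. if enat k < T then 1 else 0 :: ennreal) = (\<Sum>k<n. if enat k < T then 1 else 0)"
    by (rule suminf_finite) (auto simp: enat)
  also have "\<dots> = of_nat n" by (simp add: enat)
  finally show ?thesis by (simp add: enat)
next
  case infinity
  have "of_nat n \<le> (\<Sum>k. 1 :: ennreal)" for n
    using sum_le_suminf[of "\<lambda>_. 1 :: ennreal" "{..<n}"] by simp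
  hence "(\<Sum>k. 1 :: ennreal) = \<top>"
    using ennreal_Ex_less_of_nat[of "\<Sum>k. 1 :: ennreal"] by (meson leD less_top)
  thus ?thesis using infinity by simp
qed

context affine_iid
begin

definition mean_exit :: "real \<Rightarrow> real^'d \<Rightarrow> ennreal" where
  "mean_exit R x = (\<integral>\<^sup>+\<omega>. ennreal_of_enat (exit_time coord_A coord_B R x \<omega>) \<partial>paths)"

text \<open>The probability of \<open>\<tau>\<^sub>R(x) > k\<close>.\<close>

definition surv :: "real \<Rightarrow> nat \<Rightarrow> real^'d \<Rightarrow> ennreal" where
  "surv R k x = (\<integral>\<^sup>+\<omega>. (\<Prod>j\<le>k. indicator {..R} (norm (process x j \<omega>))) \<partial>paths)"

lemma measurable_surv [measurable]: "surv R k \<in> borel_measurable borel"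
  unfolding surv_def by measurable

text \<open>Each summand indicates survival through time k. This form gives measurability of the
  exit time and turns its mean into a sum of survival probabilities.\<close>

lemma exit_time_eq_suminf:
  "ennreal_of_enat (exit_time coord_A coord_B R x \<omega>)
    = (\<Sum>k. \<Prod>j\<le>k. indicator {..R} (norm (process x j \<omega>)))"
proof -
  have "(\<Prod>j\<le>k. indicator {..R} (norm (process x j \<omega>)))
      = (if enat k < exit_time coord_A coord_B R x \<omega> then 1 else 0 :: ennreal)" for k
    by (auto simp: exit_time_def less_Inf_enat_iff indicator_def not_less intro!: prod_zero)
  thus ?thesis by (simp add: ennreal_of_enat_eq_suminf)
qed

lemma measurable_exit_time:
  "(\<lambda>\<omega>. ennreal_of_enat (exit_time coord_A coord_B R x \<omega>)) \<in> borel_measurable paths"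
  unfolding exit_time_eq_suminf by measurable

lemma mean_exit_eq_suminf: "mean_exit R x = (\<Sum>k. surv R k x)"
  unfolding mean_exit_def surv_def exit_time_eq_suminf by (rule nn_integral_suminf) measurable

lemma surv_0: "surv R 0 x = indicator {..R} (norm x)"
  by (simp add: surv_def seq.P.emeasure_space_1)

lemma surv_Suc: "surv R (Suc k) x = indicator {..R} (norm x) * (\<integral>\<^sup>+p. surv R k (fst p *v x + snd p) \<partial>\<mu>)"
proof -
  have proc: "process x (Suc j) (comb_seq 1 \<omega> \<omega>') = process (process x 1 \<omega>) j \<omega>'" for j \<omega> \<omega>'
    using process_comb_seq[of x 1 j] by simp
  have "surv R (Suc k) x = (\<integral>\<^sup>+\<omega>. \<integral>\<^sup>+\<omega>'. indicator {..R} (norm x)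
      * (\<Prod>j\<le>k. indicator {..R} (norm (process (process x 1 \<omega>) j \<omega>'))) \<partial>paths \<partial>paths)"
    unfolding surv_def
    by (subst nn_integral_comb_seq[of _ 1]) (simp_all only: prod.atMost_Suc_shift proc affine_process.simps(1), measurable)
  also have "\<dots> = (\<integral>\<^sup>+\<omega>. indicator {..R} (norm x) * surv R k (process x 1 \<omega>) \<partial>paths)"
    unfolding surv_def by (intro nn_integral_cong nn_integral_cmult) measurable
  also have "\<dots> = indicator {..R} (norm x) * (\<integral>\<^sup>+\<omega>. surv R k (process x 1 \<omega>) \<partial>paths)"
    by (rule nn_integral_cmult) measurable
  also have "(\<integral>\<^sup>+\<omega>. surv R k (process x 1 \<omega>) \<partial>paths) = (\<integral>\<^sup>+p. surv R k (fst p *v x + snd p) \<partial>\<mu>)"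
    by (rule nn_integral_process_1) measurable
  finally show ?thesis .
qed

lemma surv_outside: "R < norm x \<Longrightarrow> surv R k x = 0"
  by (cases k) (auto simp: surv_0 surv_Suc)

subsection \<open>Upper bound\<close>

lemma emom_sum_le:
  assumes "0 < s" "mom s 1 < \<infinity>" "emom s 1 0 < \<infinity>"
  obtains c where "0 < c" "\<And>x. (\<Sum>i<N. emom s i x) \<le> ennreal (c * (1 + norm x powr s))"
proof -
  define a where "a i = enn2real (mom s i)" for i
  define b where "b i = enn2real (emom s i 0)" for i
  have ab: "mom s i = ennreal (a i)" "emom s i 0 = ennreal (b i)" "0 \<le> a i" "0 \<le> b i" for i
    using mom_finite[of s i] emom_finite[of s i 0] assms by (auto simp: a_def b_def)
  define c where "c = 1 + (\<Sum>i<N. 2 powr s * (a i + b i))"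
  have "(\<Sum>i<N. emom s i x) \<le> ennreal (c * (1 + norm x powr s))" for x
  proof -
    have "(\<Sum>i<N. emom s i x) \<le> (\<Sum>i<N. ennreal (2 powr s * (a i + b i) * (1 + norm x powr s)))"
    proof (rule sum_mono)
      fix i
      have "emom s i x \<le> ennreal (2 powr s) * (mom s i * ennreal (norm x powr s) + emom s i 0)"
        by (rule emom_le) (rule assms)
      also have "\<dots> = ennreal (2 powr s * (a i * norm x powr s + b i))"
        using ab by (simp add: ennreal_mult[symmetric] ennreal_plus[symmetric] del: ennreal_plus)
      also have "\<dots> \<le> ennreal (2 powr s * (a i + b i) * (1 + norm x powr s))"
        using ab(3,4)[of i] by (intro ennreal_leI) (simp add: algebra_simps)
      finally show "emom s i x \<le> ennreal (2 powr s * (a i + b i) * (1 + norm x powr s))" .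
    qed
    also have "\<dots> = ennreal ((\<Sum>i<N. 2 powr s * (a i + b i)) * (1 + norm x powr s))"
      unfolding sum_distrib_right using ab by (intro sum_ennreal) auto
    also have "\<dots> \<le> ennreal (c * (1 + norm x powr s))"
      by (intro ennreal_leI mult_right_mono) (auto simp: c_def)
    finally show ?thesis .
  qed
  moreover have "0 < c" unfolding c_def using ab by (intro add_pos_nonneg sum_nonneg) auto
  ultimately show ?thesis using that by blast
qed

text \<open>The sum of the first \<open>N\<close> moments is a Lyapunov function that increases by at least \<open>1\<close> in
  each step, so its value at the exit time bounds the mean exit time. The stopped value is
  controlled by the overshoot.\<close>

lemma mean_exit_le:
  assumes s: "0 < s" "mom s 1 < \<infinity>" "emom s 1 0 < \<infinity>"
    and incr: "\<And>x. ennreal (norm x powr s + 1) \<le> emom s N x"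
    and K: "0 \<le> K"
    and over: "\<And>R x. R\<^sub>0 \<le> R \<Longrightarrow> norm x \<le> R \<Longrightarrow>
      (\<integral>\<^sup>+p. ennreal (norm (fst p *v x + snd p) powr s) * indicator {R<..} (norm (fst p *v x + snd p)) \<partial>\<mu>)
        \<le> ennreal (K * R powr s) * emeasure \<mu> {p\<in>space \<mu>. R < norm (fst p *v x + snd p)}"
  obtains C where "0 < C" "\<And>R x. R\<^sub>0 \<le> R \<Longrightarrow> norm x \<le> R \<Longrightarrow> mean_exit R x \<le> ennreal (C * (1 + R powr s))"
proof -
  define V where "V x = (\<Sum>i<N. emom s i x)" for x
  have [measurable]: "V \<in> borel_measurable borel" unfolding V_def by measurable
  obtain c where c: "0 < c" "\<And>x. V x \<le> ennreal (c * (1 + norm x powr s))"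
    unfolding V_def using emom_sum_le[OF s] by blast
  \<comment> \<open>One step shifts the sum of moments: \<open>emom s 0 x\<close> leaves and
    \<open>emom s N x\<close> enters, which is larger by 1. The leaving term is finite and may be
    cancelled in \<open>ennreal\<close>.\<close>
  have V_step: "V x + 1 \<le> (\<integral>\<^sup>+p. V (fst p *v x + snd p) \<partial>\<mu>)" for x
  proof -
    have "(\<integral>\<^sup>+p. V (fst p *v x + snd p) \<partial>\<mu>) = (\<Sum>i<N. emom s (Suc i) x)"
      unfolding V_def by (simp add: nn_integral_sum emom_Suc)
    hence "ennreal (norm x powr s) + (\<integral>\<^sup>+p. V (fst p *v x + snd p) \<partial>\<mu>) = (\<Sum>i<Suc N. emom s i x)"
      by (simp add: sum.lessThan_Suc_shift del: sum.lessThan_Suc)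
    also have "\<dots> = V x + emom s N x" by (simp add: V_def)
    finally have "V x + (ennreal (norm x powr s) + 1) \<le> ennreal (norm x powr s) + (\<integral>\<^sup>+p. V (fst p *v x + snd p) \<partial>\<mu>)"
      using incr[of x] by (simp add: add_left_mono)
    hence "ennreal (norm x powr s) + (V x + 1) \<le> ennreal (norm x powr s) + (\<integral>\<^sup>+p. V (fst p *v x + snd p) \<partial>\<mu>)"
      by (simp add: ac_simps)
    thus ?thesis by (simp add: ennreal_add_left_cancel_le)
  qed
  have "mean_exit R x \<le> ennreal (c * (2 + K) * (1 + R powr s))" if R: "R\<^sub>0 \<le> R" and x: "norm x \<le> R" for R x
  proof -
    define a where "a = c * (1 + R powr s)"
    define b where "b = c * (1 + K * R powr s)"
    have ab: "0 \<le> a" "0 \<le> b" using c K by (auto simp: a_def b_def)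
    define G where "G n y = (\<Sum>k<n. surv R k y)" for n y
    have [measurable]: "G n \<in> borel_measurable borel" for n unfolding G_def by measurable
    \<comment> \<open>Optional stopping at a finite horizon, by induction on the first step.
      \<open>G n x\<close> is the mean of the exit time capped at n, a bounds V inside the ball, and
      b bounds the stopped V per unit of exit probability; the \<open>surv\<close> term reserves b
      for paths still inside at time n.\<close>
    have bound: "G n x + V x + ennreal b * surv R n x \<le> ennreal a + ennreal b" if "norm x \<le> R" for n x
      using that
    proof (induction n arbitrary: x)
      case 0
      have "V x \<le> ennreal (c * (1 + norm x powr s))" by (rule c)
      also have "\<dots> \<le> ennreal a" unfolding a_def using 0 c s
        by (intro ennreal_leI mult_left_mono add_left_mono powr_mono2) auto
      finally show ?case using 0 by (simp add: G_def surv_0)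
    next
      case (Suc n)
      define Y where "Y p = fst p *v x + snd p" for p :: "(real^'d^'d) \<times> (real^'d)"
      have [measurable]: "Y \<in> borel_measurable \<mu>" unfolding Y_def by measurable
      define u where "u = (\<integral>\<^sup>+p. indicator {..R} (norm (Y p)) \<partial>\<mu>)"
      define v where "v = (\<integral>\<^sup>+p. indicator {R<..} (norm (Y p)) \<partial>\<mu>)"
      have "u + v = (\<integral>\<^sup>+p. indicator {..R} (norm (Y p)) + indicator {R<..} (norm (Y p)) \<partial>\<mu>)"
        unfolding u_def v_def by (rule nn_integral_add[symmetric]) measurable
      also have "\<dots> = (\<integral>\<^sup>+p. 1 \<partial>\<mu>)" by (rule nn_integral_cong) (auto simp: indicator_def)
      also have "\<dots> = 1" by (simp add: emeasure_space_1)
      finally have uv: "u + v = 1" .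
      have v: "v = emeasure \<mu> {p\<in>space \<mu>. R < norm (Y p)}"
      proof -
        have "v = (\<integral>\<^sup>+p. indicator {p\<in>space \<mu>. R < norm (Y p)} p \<partial>\<mu>)"
          unfolding v_def by (rule nn_integral_cong) (auto simp: indicator_def)
        thus ?thesis by simp
      qed
      \<comment> \<open>Outside the ball \<open>G n\<close> and \<open>surv R n\<close> vanish, so
        only V at the exit point remains; its affine bound in the power is what the overshoot
        estimate integrates.\<close>
      have pointwise: "G n y + V y + ennreal b * surv R n y \<le> (ennreal a + ennreal b) * indicator {..R} (norm y)
          + (ennreal c * indicator {R<..} (norm y) + ennreal c * (ennreal (norm y powr s) * indicator {R<..} (norm y)))" for y
      proof (cases "norm y \<le> R")
        case True
        thus ?thesis using Suc.IH[OF True] by simp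
      next
        case False
        hence "G n y + V y + ennreal b * surv R n y = V y" by (simp add: G_def surv_outside)
        also have "\<dots> \<le> ennreal (c * (1 + norm y powr s))" by (rule c)
        also have "\<dots> = ennreal c + ennreal c * ennreal (norm y powr s)"
          using c(1) by (simp add: ennreal_mult[symmetric] ennreal_plus[symmetric] distrib_left del: ennreal_plus)
        finally show ?thesis using False by simp
      qed
      have G_Suc: "G (Suc n) x = 1 + (\<integral>\<^sup>+p. G n (Y p) \<partial>\<mu>)"
      proof -
        have "G (Suc n) x = surv R 0 x + (\<Sum>k<n. surv R (Suc k) x)"
          unfolding G_def by (rule sum.lessThan_Suc_shift)
        also have "\<dots> = 1 + (\<integral>\<^sup>+p. G n (Y p) \<partial>\<mu>)"
          using Suc.prems unfolding G_def Y_def by (simp add: surv_0 surv_Suc nn_integral_sum)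
        finally show ?thesis .
      qed
      have "G (Suc n) x + V x + ennreal b * surv R (Suc n) x
          = (\<integral>\<^sup>+p. G n (Y p) \<partial>\<mu>) + (V x + 1) + ennreal b * (\<integral>\<^sup>+p. surv R n (Y p) \<partial>\<mu>)"
        using Suc.prems by (simp add: G_Suc surv_Suc Y_def ac_simps)
      also have "\<dots> \<le> (\<integral>\<^sup>+p. G n (Y p) \<partial>\<mu>) + (\<integral>\<^sup>+p. V (Y p) \<partial>\<mu>) + ennreal b * (\<integral>\<^sup>+p. surv R n (Y p) \<partial>\<mu>)"
        by (intro add_right_mono add_left_mono) (use V_step[of x] in \<open>simp add: Y_def\<close>)
      also have "\<dots> = (\<integral>\<^sup>+p. G n (Y p) + V (Y p) + ennreal b * surv R n (Y p) \<partial>\<mu>)"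
        by (simp add: nn_integral_add nn_integral_cmult)
      also have "\<dots> \<le> (\<integral>\<^sup>+p. (ennreal a + ennreal b) * indicator {..R} (norm (Y p))
          + (ennreal c * indicator {R<..} (norm (Y p)) + ennreal c * (ennreal (norm (Y p) powr s) * indicator {R<..} (norm (Y p)))) \<partial>\<mu>)"
        by (intro nn_integral_mono pointwise)
      also have "\<dots> = (ennreal a + ennreal b) * u + (ennreal c * v
          + ennreal c * (\<integral>\<^sup>+p. ennreal (norm (Y p) powr s) * indicator {R<..} (norm (Y p)) \<partial>\<mu>))"
        unfolding u_def v_def by (simp add: nn_integral_add nn_integral_cmult)
      also have "\<dots> \<le> (ennreal a + ennreal b) * u + (ennreal c * v + ennreal c * (ennreal (K * R powr s) * v))"
        unfolding v using over[OF R Suc.prems] by (intro add_left_mono mult_left_mono) (auto simp: Y_def)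
      also have "ennreal c * v + ennreal c * (ennreal (K * R powr s) * v) = ennreal b * v"
      proof -
        have "ennreal b = ennreal c + ennreal c * ennreal (K * R powr s)"
          using c(1) K by (simp add: b_def ennreal_mult[symmetric] ennreal_plus[symmetric] distrib_left del: ennreal_plus)
        thus ?thesis by (simp add: distrib_right mult.assoc)
      qed
      also have "(ennreal a + ennreal b) * u + ennreal b * v \<le> (ennreal a + ennreal b) * u + (ennreal a + ennreal b) * v"
        by (intro add_left_mono mult_right_mono) auto
      also have "\<dots> = ennreal a + ennreal b"
        unfolding distrib_left[symmetric] uv by simp
      finally show ?case .
    qed
    have G: "G n x \<le> ennreal a + ennreal b" for n
      using order_trans[OF _ bound[OF x, of n], of "G n x"]
      by (simp add: add.assoc)
    have "mean_exit R x \<le> ennreal a + ennreal b"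
      unfolding mean_exit_eq_suminf by (rule suminf_le_const) (use G in \<open>auto simp: G_def\<close>)
    also have "\<dots> = ennreal (a + b)" using ab by simp
    also have "\<dots> \<le> ennreal (c * (2 + K) * (1 + R powr s))"
      using c K by (intro ennreal_leI) (simp add: a_def b_def algebra_simps)
    finally show ?thesis .
  qed
  with that[of "c * (2 + K)"] c K show ?thesis by simp
qed

subsection \<open>Lower bound\<close>

text \<open>The assumed size of \<open>mom s q\<close> cancels the factor \<open>2 powr s\<close> of
  \<open>emom_le\<close> and leaves a contraction by 1/2 per block of q steps. The remaining
  \<open>n mod q\<close> steps are covered by one affine bound for all remainders.\<close>

lemma emom_bounded:
  assumes s: "0 < s" "mom s 1 < \<infinity>" "emom s 1 0 < \<infinity>"
    and q: "1 \<le> q" "mom s q \<le> ennreal (2 powr (- s) / 2)"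
  obtains K where "0 < K" "\<And>n. emom s n x \<le> ennreal K"
proof -
  obtain D where D: "ennreal (2 powr s) * emom s q 0 = ennreal D" "0 \<le> D"
    using emom_finite[OF s, of q 0] by (cases "emom s q 0") (auto simp: ennreal_mult[symmetric])
  have block: "emom s q y \<le> ennreal (1 / 2) * ennreal (norm y powr s) + ennreal D" for y
  proof -
    have "emom s q y \<le> ennreal (2 powr s) * (mom s q * ennreal (norm y powr s) + emom s q 0)"
      by (rule emom_le) (rule s)
    also have "\<dots> = ennreal (2 powr s) * mom s q * ennreal (norm y powr s) + ennreal D"
      using D by (simp add: distrib_left mult.assoc)
    also have "ennreal (2 powr s) * mom s q \<le> ennreal (2 powr s) * ennreal (2 powr (- s) / 2)"
      by (intro mult_left_mono q) simp
    also have "\<dots> = ennreal (1 / 2)"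
      by (simp add: ennreal_mult[symmetric] powr_minus)
    finally show ?thesis by (simp add: mult_right_mono add_right_mono)
  qed
  \<comment> \<open>\<open>2 * D\<close> is the fixed point of halving and adding D.\<close>
  have iter: "emom s (i * q) x \<le> ennreal (norm x powr s + 2 * D)" for i
  proof (induction i)
    case (Suc i)
    have "emom s (Suc i * q) x = (\<integral>\<^sup>+\<omega>. emom s q (process x (i * q) \<omega>) \<partial>paths)"
      using emom_add[of s "i * q" q x] by (simp add: add.commute)
    also have "\<dots> \<le> (\<integral>\<^sup>+\<omega>. ennreal (1 / 2) * ennreal (norm (process x (i * q) \<omega>) powr s) + ennreal D \<partial>paths)"
      by (intro nn_integral_mono block)
    also have "\<dots> = ennreal (1 / 2) * emom s (i * q) x + ennreal D"
      by (subst nn_integral_add) (auto simp: nn_integral_cmult seq.P.emeasure_space_1 emom_def)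
    also have "\<dots> \<le> ennreal (1 / 2) * ennreal (norm x powr s + 2 * D) + ennreal D"
      by (intro add_right_mono mult_left_mono Suc) simp
    also have "\<dots> = ennreal (1 / 2 * (norm x powr s + 2 * D) + D)"
      using D by (subst ennreal_mult[symmetric], simp, simp, subst ennreal_plus[symmetric]) auto
    also have "\<dots> \<le> ennreal (norm x powr s + 2 * D)"
      by (intro ennreal_leI) simp
    finally show ?case .
  qed (use D in simp)
  obtain c where c: "0 < c" "\<And>y. (\<Sum>i<q. emom s i y) \<le> ennreal (c * (1 + norm y powr s))"
    using emom_sum_le[OF s] by blast
  have "emom s n x \<le> ennreal (c * (1 + (norm x powr s + 2 * D)))" for n
  proof -
    have "emom s n x = (\<integral>\<^sup>+\<omega>. emom s (n mod q) (process x (n div q * q) \<omega>) \<partial>paths)"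
      using emom_add[of s "n div q * q" "n mod q" x] by simp
    also have "\<dots> \<le> (\<integral>\<^sup>+\<omega>. ennreal c * (1 + ennreal (norm (process x (n div q * q) \<omega>) powr s)) \<partial>paths)"
    proof (intro nn_integral_mono)
      fix \<omega>
      define y where "y = process x (n div q * q) \<omega>"
      have "emom s (n mod q) y \<le> (\<Sum>i<q. emom s i y)"
        by (rule member_le_sum) (use q in auto)
      also have "\<dots> \<le> ennreal (c * (1 + norm y powr s))" by (rule c)
      also have "\<dots> = ennreal c * (1 + ennreal (norm y powr s))" using c(1) by (simp add: ennreal_mult)
      finally show "emom s (n mod q) (process x (n div q * q) \<omega>)
          \<le> ennreal c * (1 + ennreal (norm (process x (n div q * q) \<omega>) powr s))" by (simp add: y_def)
    qed
    also have "\<dots> = ennreal c * (1 + emom s (n div q * q) x)"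
      by (simp add: nn_integral_cmult nn_integral_add seq.P.emeasure_space_1 emom_def)
    also have "\<dots> \<le> ennreal c * (1 + ennreal (norm x powr s + 2 * D))"
      by (intro mult_left_mono add_left_mono iter) simp
    also have "\<dots> = ennreal (c * (1 + (norm x powr s + 2 * D)))"
      using c(1) D by (simp add: ennreal_mult ennreal_1[symmetric] ennreal_plus[symmetric] del: ennreal_1 ennreal_plus)
    finally show ?thesis .
  qed
  moreover have "0 < c * (1 + (norm x powr s + 2 * D))"
    using c D by (intro mult_pos_pos add_pos_nonneg) auto
  ultimately show ?thesis using that by blast
qed

text \<open>Union bound and Markov's inequality in one pointwise estimate: if the path leaves the
  ball by time k, some term of the sum already reaches \<open>R powr s\<close>.\<close>

lemma surv_ge:
  assumes "0 < s" "0 < R"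
  shows "1 \<le> surv R k x + ennreal (R powr (- s)) * (\<Sum>j\<le>k. emom s j x)"
proof -
  have "(1 :: ennreal) = (\<integral>\<^sup>+\<omega>. 1 \<partial>paths)" by (simp add: seq.P.emeasure_space_1)
  also have "\<dots> \<le> (\<integral>\<^sup>+\<omega>. (\<Prod>j\<le>k. indicator {..R} (norm (process x j \<omega>)))
      + ennreal (R powr (- s)) * (\<Sum>j\<le>k. ennreal (norm (process x j \<omega>) powr s)) \<partial>paths)"
  proof (intro nn_integral_mono)
    fix \<omega>
    show "1 \<le> (\<Prod>j\<le>k. indicator {..R} (norm (process x j \<omega>)))
      + ennreal (R powr (- s)) * (\<Sum>j\<le>k. ennreal (norm (process x j \<omega>) powr s))"
    proof (cases "\<forall>j\<le>k. norm (process x j \<omega>) \<le> R")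
      case True
      hence "(\<Prod>j\<le>k. indicator {..R} (norm (process x j \<omega>))) = (1 :: ennreal)"
        by (intro prod.neutral) auto
      thus ?thesis by simp
    next
      case False
      then obtain j where j: "j \<le> k" "R < norm (process x j \<omega>)" by (auto simp: not_le)
      have "R powr s \<le> norm (process x j \<omega>) powr s"
        by (intro powr_mono2) (use j assms in auto)
      hence "1 \<le> R powr (- s) * norm (process x j \<omega>) powr s"
        using assms by (simp add: powr_minus field_simps)
      hence "1 \<le> ennreal (R powr (- s)) * ennreal (norm (process x j \<omega>) powr s)"
        by (simp add: ennreal_mult[symmetric])
      also have "\<dots> \<le> ennreal (R powr (- s)) * (\<Sum>j\<le>k. ennreal (norm (process x j \<omega>) powr s))"
        by (intro mult_left_mono member_le_sum) (use j in auto)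
      finally show ?thesis by (simp add: add_increasing)
    qed
  qed
  also have "\<dots> = surv R k x + ennreal (R powr (- s)) * (\<Sum>j\<le>k. emom s j x)"
    unfolding surv_def emom_def by (simp add: nn_integral_add nn_integral_cmult nn_integral_sum del: sum_ennreal)
  finally show ?thesis .
qed

lemma mean_exit_ge:
  assumes s: "0 < s" and K: "0 < K" "\<And>n. emom s n x \<le> ennreal K" and R: "0 < R"
  shows "ennreal (R powr s / (4 * K) - 1 / 2) \<le> mean_exit R x"
proof -
  \<comment> \<open>For the first n times the failure probability is at most 1/2, so the mean is at
    least n/2; the subtracted 1/2 in the claim pays for rounding down.\<close>
  define n where "n = nat \<lfloor>R powr s / (2 * K)\<rfloor>"
  have "0 \<le> R powr s / (2 * K)" using K by simp
  hence n: "real n \<le> R powr s / (2 * K)" "R powr s / (2 * K) \<le> real n + 1"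
    unfolding n_def by linarith+
  have half: "ennreal (1 / 2) \<le> surv R k x" if "k < n" for k
  proof -
    have "(\<Sum>j\<le>k. emom s j x) \<le> (\<Sum>j\<le>k. ennreal K)" by (intro sum_mono K)
    also have "\<dots> = ennreal ((real k + 1) * K)"
      using K by (simp add: ennreal_mult ennreal_of_nat_eq_real_of_nat add.commute)
    also have "\<dots> \<le> ennreal (R powr s / 2)"
    proof (intro ennreal_leI)
      have "(real k + 1) * K \<le> real n * K" using that K by (intro mult_right_mono) auto
      also have "\<dots> \<le> R powr s / 2" using n(1) K by (simp add: field_simps)
      finally show "(real k + 1) * K \<le> R powr s / 2" .
    qed
    finally have "ennreal (R powr (- s)) * (\<Sum>j\<le>k. emom s j x) \<le> ennreal (R powr (- s)) * ennreal (R powr s / 2)"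
      by (rule mult_left_mono) simp
    also have "\<dots> = ennreal (1 / 2)" using R by (simp add: ennreal_mult[symmetric] powr_minus)
    finally have "1 \<le> surv R k x + ennreal (1 / 2)"
      using order_trans[OF surv_ge[OF s R, of k x] add_left_mono] by blast
    moreover have "(1 :: ennreal) = ennreal (1 / 2) + ennreal (1 / 2)"
      by (subst ennreal_plus[symmetric]) auto
    ultimately have "ennreal (1 / 2) + ennreal (1 / 2) \<le> ennreal (1 / 2) + surv R k x"
      by (simp only: add.commute)
    thus ?thesis by (simp add: ennreal_add_left_cancel_le)
  qed
  have "ennreal (R powr s / (4 * K) - 1 / 2) \<le> ennreal (real n * (1 / 2))"
    using n(2) K by (intro ennreal_leI) (simp add: field_simps)
  also have "\<dots> = (\<Sum>k<n. ennreal (1 / 2))"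
    by (subst sum_ennreal) auto
  also have "\<dots> \<le> (\<Sum>k<n. surv R k x)" by (intro sum_mono half) simp
  also have "\<dots> \<le> mean_exit R x"
    unfolding mean_exit_eq_suminf by (rule sum_le_suminf) auto
  finally show ?thesis .
qed

end

section \<open>The limit\<close>

lemma log_ext_mono: "x \<le> y \<Longrightarrow> log_ext x \<le> log_ext y"
  by (cases x; cases y) (auto simp: log_ext_def ennreal_le_iff2 top_unique)

lemma log_ext_ennreal: "0 < v \<Longrightarrow> log_ext (ennreal v) = ereal (ln v)"
  by (simp add: log_ext_def)

context affine_iid
begin

lemma mom_1_finite_mono:
  assumes "0 < s" "s \<le> t" "mom t 1 < \<infinity>"
  shows "mom s 1 < \<infinity>"
proof -
  \<comment> \<open>Interpolation with threshold 1 between exponents 0 and t. At exponent 0 only an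
    inequality holds, since \<open>0 powr 0 = 0\<close>.\<close>
  have "mom s 1 \<le> ennreal (1 powr (s - 0)) * mom 0 1 + ennreal (1 powr (s - t)) * mom t 1"
    by (rule mom_interpolation) (use assms in auto)
  also have "mom 0 1 \<le> 1"
  proof -
    have "mom 0 1 \<le> (\<integral>\<^sup>+\<omega>. 1 \<partial>paths)" unfolding mom_def norm_moment_def by (intro nn_integral_mono) auto
    thus ?thesis by (simp add: seq.P.emeasure_space_1)
  qed
  finally have "mom s 1 \<le> 1 + mom t 1" by (simp add: add_right_mono)
  also have "\<dots> < \<infinity>" using assms by simp
  finally show ?thesis .
qed

text \<open>From the start 0 the process after one step is B. The overshoot bound at a single radius
  therefore yields the moment of B of order s, which is not a hypothesis of the theorem.\<close>

lemma emom_1_zero_finite: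
  assumes "0 < R" "0 < s"
    and over: "(\<integral>\<^sup>+p. ennreal (norm (fst p *v 0 + snd p) powr s) * indicator {R<..} (norm (fst p *v 0 + snd p)) \<partial>\<mu>)
        \<le> ennreal (K * R powr s) * emeasure \<mu> {p\<in>space \<mu>. R < norm (fst p *v 0 + snd p)}"
  shows "emom s 1 0 < \<infinity>"
proof -
  have "emom s 1 0 = (\<integral>\<^sup>+p. ennreal (norm (fst p *v 0 + snd p) powr s) \<partial>\<mu>)"
    using emom_Suc[of s 0 0] by simp
  also have "\<dots> \<le> (\<integral>\<^sup>+p. ennreal (R powr s)
      + ennreal (norm (fst p *v 0 + snd p) powr s) * indicator {R<..} (norm (fst p *v 0 + snd p)) \<partial>\<mu>)"
  proof (intro nn_integral_mono)
    fix p
    show "ennreal (norm (fst p *v 0 + snd p) powr s) \<le> ennreal (R powr s)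
        + ennreal (norm (fst p *v 0 + snd p) powr s) * indicator {R<..} (norm (fst p *v 0 + snd p))"
      by (cases "R < norm (fst p *v 0 + snd p)")
         (use powr_mono2[of s "norm (fst p *v 0 + snd p)" R] assms(2) in \<open>auto simp: ennreal_leI\<close>)
  qed
  also have "\<dots> = ennreal (R powr s)
      + (\<integral>\<^sup>+p. ennreal (norm (fst p *v 0 + snd p) powr s) * indicator {R<..} (norm (fst p *v 0 + snd p)) \<partial>\<mu>)"
    by (subst nn_integral_add) (auto simp: emeasure_space_1)
  also have "\<dots> \<le> ennreal (R powr s) + ennreal (K * R powr s) * emeasure \<mu> {p\<in>space \<mu>. R < norm (fst p *v 0 + snd p)}"
    by (intro add_left_mono over)
  also have "\<dots> < \<infinity>" by (simp add: ennreal_mult_less_top emeasure_eq_measure)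
  finally show ?thesis .
qed

text \<open>Polynomial bounds of order s hold for every s on either side of alpha, with constants
  that may degenerate as s approaches it. Taking logarithms removes the constants, so s can be
  chosen after the neighbourhood of alpha.\<close>

lemma mean_exit_log_limit:
  assumes lyap: "lyapunov_exponent paths coord_A < 0"
    and a: "0 < \<alpha>" "h_moment paths coord_A \<alpha> = 1"
    and \<beta>: "\<alpha> < \<beta>" "mom \<beta> 1 < \<infinity>"
    and \<nu>: "prob_space \<nu>" "sets \<nu> = sets borel"
      "distr (\<nu> \<Otimes>\<^sub>M \<mu>) borel (\<lambda>(x, p). fst p *v x + snd p) = \<nu>"
    and unbounded: "\<And>L. 0 < measure \<nu> {x. L < norm x}"
    and R\<^sub>0: "1 < R\<^sub>0" "1 < z\<^sub>0"
    and tail: "\<And>R z x. R\<^sub>0 \<le> R \<Longrightarrow> z\<^sub>0 \<le> z \<Longrightarrow> norm x \<le> R \<Longrightarrow>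
      measure \<mu> {p\<in>space \<mu>. z * R < norm (fst p *v x + snd p)}
        \<le> C * z powr (- \<beta>) * measure \<mu> {p\<in>space \<mu>. R < norm (fst p *v x + snd p)}"
    and n\<^sub>0: "1 \<le> n\<^sub>0" and nondeg: "\<And>x y. x \<noteq> 0 \<Longrightarrow> y \<noteq> 0 \<Longrightarrow>
      measure paths {\<omega>\<in>space paths. x \<bullet> (product n\<^sub>0 \<omega> *v y) = 0} < 1"
  shows "((\<lambda>R. log_ext (mean_exit R x\<^sub>0) / ereal (ln R)) \<longlongrightarrow> ereal \<alpha>) at_top"
proof -
  define K where "K s = z\<^sub>0 powr s * max 1 C / (1 - z\<^sub>0 powr (s - \<beta>))" for s
  have K: "0 \<le> K s" if "s < \<beta>" for s
    using powr_less_one[of z\<^sub>0 "s - \<beta>"] R\<^sub>0 that by (simp add: K_def)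
  have over: "(\<integral>\<^sup>+p. ennreal (norm (fst p *v x + snd p) powr s) * indicator {R<..} (norm (fst p *v x + snd p)) \<partial>\<mu>)
      \<le> ennreal (K s * R powr s) * emeasure \<mu> {p\<in>space \<mu>. R < norm (fst p *v x + snd p)}"
    if "0 < s" "s < \<beta>" "R\<^sub>0 \<le> R" "norm x \<le> R" for s R x
    unfolding K_def by (rule overshoot_moment_le) (use that R\<^sub>0 tail in auto)
  have mom1: "mom s 1 < \<infinity>" if "0 < s" "s < \<beta>" for s
    by (rule mom_1_finite_mono[of s \<beta>]) (use that \<beta> in auto)
  have emom1: "emom s 1 0 < \<infinity>" if "0 < s" "s < \<beta>" for s
  proof (rule emom_1_zero_finite)
    show "0 < R\<^sub>0" using R\<^sub>0 by simp
    thus "(\<integral>\<^sup>+p. ennreal (norm (fst p *v 0 + snd p) powr s) * indicator {R\<^sub>0<..} (norm (fst p *v 0 + snd p)) \<partial>\<mu>)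
        \<le> ennreal (K s * R\<^sub>0 powr s) * emeasure \<mu> {p\<in>space \<mu>. R\<^sub>0 < norm (fst p *v 0 + snd p)}"
      by (intro over that) auto
  qed (rule that)
  have \<alpha>1: "mom \<alpha> 1 < \<infinity>" by (rule mom1) (use a \<beta> in auto)
  have upper: "\<exists>C>0. \<forall>\<^sub>F R in at_top. mean_exit R x\<^sub>0 \<le> ennreal (C * (1 + R powr s))"
    if s: "\<alpha> < s" "s < \<beta>" for s
  proof -
    obtain m r where m: "1 \<le> m" "0 < r" "r < \<alpha>" "mom r m < 1"
      using lyapunov_neg_imp_mom_less_1[OF a(1) \<alpha>1 lyap a(1)] by blast
    have s0: "0 < s" using a s by simp
    obtain N D where N: "1 \<le> N" "1 \<le> D" "\<And>x. ennreal (2 * norm x powr s) \<le> emom s N x + ennreal D"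
      by (rule emom_block_growth[OF m(2,1,4,3) s(1) \<alpha>1 a(2) mom1[OF s0 s(2)] emom1[OF s0 s(2)] n\<^sub>0])
         (rule nondeg, assumption+, rule that)
    have reach: "\<exists>j p. 0 < p \<and> (\<forall>x. norm x \<le> L \<longrightarrow>
        ennreal p \<le> emeasure paths {\<omega>\<in>space paths. L < norm (process x (j * N) \<omega>)})" for L
      by (rule reach_large_values[OF \<nu> unbounded m(2,4) N(1), where L=L]) blast
    obtain n where n: "\<And>x. ennreal (norm x powr s + 1) \<le> emom s n x"
      by (rule emom_increment[OF N s0 reach]) (rule that)
    obtain C where C: "0 < C" "\<And>R x. R\<^sub>0 \<le> R \<Longrightarrow> norm x \<le> R \<Longrightarrow> mean_exit R x \<le> ennreal (C * (1 + R powr s))"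
      by (rule mean_exit_le[OF s0 mom1[OF s0 s(2)] emom1[OF s0 s(2)] n K[OF s(2)]])
         (rule over[OF s0 s(2)], assumption, assumption, rule that)
    have "\<forall>\<^sub>F R in at_top. mean_exit R x\<^sub>0 \<le> ennreal (C * (1 + R powr s))"
      using eventually_ge_at_top[of "max R\<^sub>0 (norm x\<^sub>0)"] by eventually_elim (auto intro: C)
    thus ?thesis using C(1) by blast
  qed
  have lower: "\<exists>K>0. \<forall>\<^sub>F R in at_top. ennreal (R powr s / (4 * K) - 1 / 2) \<le> mean_exit R x\<^sub>0"
    if s: "0 < s" "s < \<alpha>" for s
  proof -
    obtain m r where m: "1 \<le> m" "0 < r" "r < s" "mom r m < 1"
      using lyapunov_neg_imp_mom_less_1[OF a(1) \<alpha>1 lyap s(1)] by blast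
    obtain k where k: "1 \<le> k" "mom s (k * m) < ennreal (2 powr (- s) / 2)"
      using mom_small_below_critical[OF m(2,1,4,3) s(2) \<alpha>1 a(2), of "2 powr (- s) / 2"] by auto
    have s\<beta>: "s < \<beta>" using s \<beta> by simp
    have "1 \<le> k * m" using k m by simp
    from emom_bounded[OF s(1) mom1[OF s(1) s\<beta>] emom1[OF s(1) s\<beta>] this less_imp_le[OF k(2)]]
    obtain K where K: "0 < K" "\<And>n. emom s n x\<^sub>0 \<le> ennreal K" by blast
    have "\<forall>\<^sub>F R in at_top. ennreal (R powr s / (4 * K) - 1 / 2) \<le> mean_exit R x\<^sub>0"
      using eventually_gt_at_top[of 0] by eventually_elim (rule mean_exit_ge[OF s(1) K])
    thus ?thesis using K(1) by blast
  qed
  show ?thesis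
  proof (rule order_tendstoI)
    fix l assume "l < ereal \<alpha>"
    \<comment> \<open>The maximum forces the chosen s to be positive, as the lower bound
      requires.\<close>
    hence "max l 0 < ereal \<alpha>" using a by simp
    then obtain s where s: "max l 0 < ereal s" "ereal s < ereal \<alpha>"
      using ereal_dense2 by blast
    hence s0: "0 < s" "s < \<alpha>" "l < ereal s" by auto
    then obtain K where K: "0 < K" "\<forall>\<^sub>F R in at_top. ennreal (R powr s / (4 * K) - 1 / 2) \<le> mean_exit R x\<^sub>0"
      using lower by blast
    have "((\<lambda>R. ln (R powr s / (4 * K) - 1 / 2) / ln R) \<longlongrightarrow> s) at_top"
      using s0 K(1) by real_asymp
    hence "((\<lambda>R. ereal (ln (R powr s / (4 * K) - 1 / 2) / ln R)) \<longlongrightarrow> ereal s) at_top" by simp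
    hence ev1: "\<forall>\<^sub>F R in at_top. l < ereal (ln (R powr s / (4 * K) - 1 / 2) / ln R)"
      by (rule order_tendstoD) (rule s0)
    have ev2: "\<forall>\<^sub>F R in at_top. 0 < R powr s / (4 * K) - 1 / 2"
      using s0 K(1) by real_asymp
    show "\<forall>\<^sub>F R in at_top. l < log_ext (mean_exit R x\<^sub>0) / ereal (ln R)"
      using ev1 ev2 K(2) eventually_gt_at_top[of 1]
    proof eventually_elim
      case (elim R)
      have "ereal (ln (R powr s / (4 * K) - 1 / 2) / ln R) = log_ext (ennreal (R powr s / (4 * K) - 1 / 2)) / ereal (ln R)"
        unfolding log_ext_ennreal[OF elim(2)] using elim(4) by simp
      also have "\<dots> \<le> log_ext (mean_exit R x\<^sub>0) / ereal (ln R)"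
        by (intro ereal_divide_right_mono log_ext_mono) (use elim in auto)
      finally show ?case using elim by simp
    qed
  next
    fix l assume "ereal \<alpha> < l"
    hence "ereal \<alpha> < min l (ereal \<beta>)" using \<beta> by simp
    then obtain s where s: "ereal \<alpha> < ereal s" "ereal s < min l (ereal \<beta>)"
      using ereal_dense2 by blast
    hence s0: "\<alpha> < s" "s < \<beta>" "ereal s < l" by auto
    hence "0 < s" using a by simp
    from s0 obtain C where C: "0 < C" "\<forall>\<^sub>F R in at_top. mean_exit R x\<^sub>0 \<le> ennreal (C * (1 + R powr s))"
      using upper by blast
    have "((\<lambda>R. ln (C * (1 + R powr s)) / ln R) \<longlongrightarrow> s) at_top"
      using \<open>0 < s\<close> C(1) by real_asymp
    hence "((\<lambda>R. ereal (ln (C * (1 + R powr s)) / ln R)) \<longlongrightarrow> ereal s) at_top" by simp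
    hence ev1: "\<forall>\<^sub>F R in at_top. ereal (ln (C * (1 + R powr s)) / ln R) < l"
      by (rule order_tendstoD) (rule s0)
    show "\<forall>\<^sub>F R in at_top. log_ext (mean_exit R x\<^sub>0) / ereal (ln R) < l"
      using ev1 C(2) eventually_gt_at_top[of 1]
    proof eventually_elim
      case (elim R)
      have "0 < C * (1 + R powr s)" using C(1) by (intro mult_pos_pos add_pos_nonneg) auto
      hence "log_ext (ennreal (C * (1 + R powr s))) / ereal (ln R) = ereal (ln (C * (1 + R powr s)) / ln R)"
        using elim by (simp add: log_ext_ennreal)
      moreover have "log_ext (mean_exit R x\<^sub>0) / ereal (ln R) \<le> log_ext (ennreal (C * (1 + R powr s))) / ereal (ln R)"
        by (intro ereal_divide_right_mono log_ext_mono) (use elim in auto)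
      ultimately show ?case using elim by simp
    qed
  qed
qed

end

section \<open>Transfer to an arbitrary probability space\<close>

definition driving_sequence ::
  "(nat \<Rightarrow> 'w \<Rightarrow> real^'d^'d) \<Rightarrow> (nat \<Rightarrow> 'w \<Rightarrow> real^'d) \<Rightarrow> 'w \<Rightarrow> nat \<Rightarrow> (real^'d^'d) \<times> (real^'d)" where
  "driving_sequence As Bs \<omega> = (\<lambda>n. (As (Suc n) \<omega>, Bs (Suc n) \<omega>))"

lemma mat_prod_driving_sequence: "mat_prod As n \<omega> = product n (driving_sequence As Bs \<omega>)"
  by (induction n) (auto simp: driving_sequence_def coord_A_def)

lemma affine_process_driving_sequence:
  "affine_process As Bs x n \<omega> = process x n (driving_sequence As Bs \<omega>)"
  by (induction n) (auto simp: driving_sequence_def coord_A_def coord_B_def)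

text \<open>Independence together with equal marginals makes the joint law over the indices from 1
  on a product measure; reindexing by \<open>Suc\<close> moves it to sequences indexed from
  0.\<close>

lemma distr_driving_sequence:
  fixes M :: "'w measure" and A :: "'w \<Rightarrow> real^'d^'d" and B :: "'w \<Rightarrow> real^'d"
  assumes "prob_space M" and iid: "iid_copies M A B As Bs"
    and \<mu>: "\<mu> = distr M borel (\<lambda>\<omega>. (A \<omega>, B \<omega>))" "prob_space \<mu>"
  shows measurable_driving_sequence: "driving_sequence As Bs \<in> measurable M (Pi\<^sub>M UNIV (\<lambda>_. \<mu>))"
    and "distr M (Pi\<^sub>M UNIV (\<lambda>_. \<mu>)) (driving_sequence As Bs) = Pi\<^sub>M UNIV (\<lambda>_. \<mu>)"
proof -
  interpret prob_space M by fact
  define X where "X = (\<lambda>n \<omega>. (As n \<omega>, Bs n \<omega>))"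
  have indep: "indep_vars (\<lambda>_. borel) X {1..}" and law: "\<And>n. 1 \<le> n \<Longrightarrow> distr M borel (X n) = \<mu>"
    using iid by (auto simp: iid_copies_def X_def \<mu>)
  have sets_\<mu> [measurable_cong]: "sets \<mu> = sets borel" by (simp add: \<mu>)
  have space_\<mu>: "space \<mu> = UNIV" by (simp add: \<mu>)
  have rv: "random_variable borel (X n)" if "1 \<le> n" for n
    using indep that by (auto simp: indep_vars_def)
  have rv': "X n \<in> measurable M \<mu>" if "1 \<le> n" for n
    using rv[OF that] by measurable
  show meas: "driving_sequence As Bs \<in> measurable M (Pi\<^sub>M UNIV (\<lambda>_. \<mu>))"
    by (rule measurable_PiM_single') (use rv' in \<open>auto simp: driving_sequence_def X_def space_\<mu>\<close>)
  have "distr M (Pi\<^sub>M {1..} (\<lambda>_. borel)) (\<lambda>\<omega>. \<lambda>n\<in>{1..}. X n \<omega>) = Pi\<^sub>M {1..} (\<lambda>n. distr M borel (X n))"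
    using indep by (subst (asm) indep_vars_iff_distr_eq_PiM') (use rv in auto)
  also have "\<dots> = Pi\<^sub>M {1..} (\<lambda>_. \<mu>)" by (rule PiM_cong) (use law in auto)
  finally have joint: "distr M (Pi\<^sub>M {1..} (\<lambda>_. \<mu>)) (\<lambda>\<omega>. \<lambda>n\<in>{1..}. X n \<omega>) = Pi\<^sub>M {1..} (\<lambda>_. \<mu>)"
    by (subst distr_cong[OF refl _ refl, of _ "Pi\<^sub>M {1..} (\<lambda>_. borel)"]) (auto intro!: sets_PiM_cong sets_\<mu>)
  have "Pi\<^sub>M UNIV (\<lambda>_. \<mu>) = distr (Pi\<^sub>M {1..} (\<lambda>_. \<mu>)) (Pi\<^sub>M UNIV (\<lambda>_. \<mu>)) (\<lambda>\<omega>. \<lambda>n\<in>UNIV. \<omega> (Suc n))"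
    using distr_PiM_reindex[of "{1..}" "\<lambda>_. \<mu>" Suc UNIV] \<mu>(2) by auto
  also have "\<dots> = distr (distr M (Pi\<^sub>M {1..} (\<lambda>_. \<mu>)) (\<lambda>\<omega>. \<lambda>n\<in>{1..}. X n \<omega>)) (Pi\<^sub>M UNIV (\<lambda>_. \<mu>))
      (\<lambda>\<omega>. \<lambda>n\<in>UNIV. \<omega> (Suc n))"
    by (simp only: joint)
  also have "\<dots> = distr M (Pi\<^sub>M UNIV (\<lambda>_. \<mu>)) ((\<lambda>\<omega>. \<lambda>n\<in>UNIV. \<omega> (Suc n)) \<circ> (\<lambda>\<omega>. \<lambda>n\<in>{1..}. X n \<omega>))"
  proof (rule distr_distr)
    show "(\<lambda>\<omega>. \<lambda>n\<in>UNIV. \<omega> (Suc n)) \<in> measurable (Pi\<^sub>M {1..} (\<lambda>_. \<mu>)) (Pi\<^sub>M UNIV (\<lambda>_. \<mu>))"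
      by (rule measurable_restrict) (rule measurable_component_singleton, simp)
    show "(\<lambda>\<omega>. \<lambda>n\<in>{1..}. X n \<omega>) \<in> measurable M (Pi\<^sub>M {1..} (\<lambda>_. \<mu>))"
      by (rule measurable_restrict) (use rv' in auto)
  qed
  also have "(\<lambda>\<omega>. \<lambda>n\<in>UNIV. \<omega> (Suc n)) \<circ> (\<lambda>\<omega>. \<lambda>n\<in>{1..}. X n \<omega>) = driving_sequence As Bs"
    by (auto simp: fun_eq_iff driving_sequence_def X_def)
  finally show "distr M (Pi\<^sub>M UNIV (\<lambda>_. \<mu>)) (driving_sequence As Bs) = Pi\<^sub>M UNIV (\<lambda>_. \<mu>)" ..
qed

text \<open>Trades the possibly infinite exponent for a smaller real one, which weakens the bound
  since z > 1. For an infinite exponent the quotient is 0 and the probability on the left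
  vanishes.\<close>

lemma tail_bound_real:
  fixes C z \<beta> a b :: real
  assumes "ereal a \<le> ereal C / powr_ext z \<alpha>\<^sub>p * ereal b" "ereal \<beta> < \<alpha>\<^sub>p" "1 < z" "0 < C" "0 \<le> b"
  shows "a \<le> C * z powr (- \<beta>) * b"
proof (cases \<alpha>\<^sub>p)
  case (real p)
  have "a \<le> C / z powr p * b" using assms real by (simp add: powr_ext_def)
  also have "\<dots> = C * z powr (- p) * b" by (simp add: powr_minus divide_inverse)
  also have "\<dots> \<le> C * z powr (- \<beta>) * b"
    using assms real by (intro mult_right_mono mult_left_mono powr_mono) auto
  finally show ?thesis .
next
  case PInf
  hence "a \<le> 0" using assms by (simp add: powr_ext_def flip: zero_ereal_def)
  also have "0 \<le> C * z powr (- \<beta>) * b" using assms by simp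
  finally show ?thesis .
qed (use assms in simp)

lemma measure_tail_pos_of_unbounded_support:
  fixes \<nu> :: "(real^'d) measure"
  assumes "prob_space \<nu>" "sets \<nu> = sets borel" "\<not> bounded (measure_support \<nu>)"
  shows "0 < measure \<nu> {x. L < norm x}"
proof -
  interpret prob_space \<nu> by fact
  obtain x where x: "x \<in> measure_support \<nu>" "L < norm x"
    using assms(3) unfolding bounded_iff by (meson not_le)
  have "open {x :: real^'d. L < norm x}" by (intro open_Collect_less continuous_intros)
  hence "0 < emeasure \<nu> {x. L < norm x}" using x unfolding measure_support_def by auto
  thus ?thesis by (simp add: emeasure_eq_measure)
qed

text \<open>Moments, tails and exit times depend on the probability space only through the law of
  the driving sequence, so hypotheses and conclusion are carried along \<open>Z\<close> to the
  product space.\<close>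

theorem theorem3p4:
  fixes M :: "'w measure"
    and A :: "'w \<Rightarrow> real^'d^'d" and B :: "'w \<Rightarrow> real^'d"
    and As :: "nat \<Rightarrow> 'w \<Rightarrow> real^'d^'d" and Bs :: "nat \<Rightarrow> 'w \<Rightarrow> real^'d"
    and \<nu> :: "(real^'d) measure"
    and s\<^sub>1 \<alpha> R\<^sub>0 z\<^sub>0 C\<^sub>0 :: real and \<alpha>\<^sub>p :: ereal and n\<^sub>0 :: nat
  assumes "prob_space M"
    and "A \<in> borel_measurable M" and "B \<in> borel_measurable M"
    and "iid_copies M A B As Bs"
    and a: "lyapunov_exponent M As < 0"
    and b: "\<exists>s>0. norm_moment M A s < \<infinity>"
    and c: "(\<integral>\<^sup>+\<omega>. ennreal (ln (max (norm (B \<omega>)) 1)) \<partial>M) < \<infinity>"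
    and d: "\<forall>x. measure M {\<omega> \<in> space M. A \<omega> *v x + B \<omega> = x} < 1"
    and e: "s\<^sub>1 > 0" "h_moment M As s\<^sub>1 > 1"
           "\<alpha> > 0" "ereal \<alpha> < moment_index M A" "h_moment M As \<alpha> = 1"
    and f: "stationary_distribution M A B \<nu>" "\<not> bounded (measure_support \<nu>)"
    and g: "R\<^sub>0 > 1" "z\<^sub>0 > 1" "C\<^sub>0 > 0" "ereal \<alpha> < \<alpha>\<^sub>p" "\<alpha>\<^sub>p \<le> moment_index M A"
           "\<forall>R\<ge>R\<^sub>0. \<forall>z\<ge>z\<^sub>0. \<forall>x. norm x \<le> R \<longrightarrow>
              ereal (measure M {\<omega> \<in> space M. norm (A \<omega> *v x + B \<omega>) > z * R})
                \<le> ereal C\<^sub>0 / powr_ext z \<alpha>\<^sub>p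
                    * ereal (measure M {\<omega> \<in> space M. norm (A \<omega> *v x + B \<omega>) > R})"
    and h: "n\<^sub>0 \<ge> 1"
           "\<forall>x y. x \<noteq> 0 \<longrightarrow> y \<noteq> 0 \<longrightarrow>
              measure M {\<omega> \<in> space M. x \<bullet> (mat_prod As n\<^sub>0 \<omega> *v y) = 0} < 1"
  shows "\<forall>x\<^sub>0. ((\<lambda>R. log_ext (\<integral>\<^sup>+\<omega>. ennreal_of_enat (exit_time As Bs R x\<^sub>0 \<omega>) \<partial>M) / ereal (ln R))
                \<longlongrightarrow> ereal \<alpha>) at_top"
proof
  fix x\<^sub>0
  interpret M: prob_space M by fact
  note [measurable] = \<open>A \<in> borel_measurable M\<close> \<open>B \<in> borel_measurable M\<close>
  define \<mu> where "\<mu> = distr M borel (\<lambda>\<omega>. (A \<omega>, B \<omega>))"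
  have AB: "(\<lambda>\<omega>. (A \<omega>, B \<omega>)) \<in> borel_measurable M" by (rule borel_measurable_Pair) fact+
  interpret mu: affine_iid \<mu>
  proof (rule affine_iid.intro)
    show "prob_space \<mu>" unfolding \<mu>_def by (rule M.prob_space_distr) (rule AB)
    show "affine_iid_axioms \<mu>" by unfold_locales (simp add: \<mu>_def)
  qed
  have AB' [measurable]: "(\<lambda>\<omega>. (A \<omega>, B \<omega>)) \<in> measurable M \<mu>"
    using AB by (simp add: measurable_cong_sets[OF refl mu.sets_mu])
  have distr_AB: "distr M \<mu> (\<lambda>\<omega>. (A \<omega>, B \<omega>)) = \<mu>"
    by (subst (2) \<mu>_def) (rule distr_cong, auto simp: mu.sets_mu)
  define Z where "Z = driving_sequence As Bs"
  have Z [measurable]: "Z \<in> measurable M mu.paths"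
    and distr_Z: "distr M mu.paths Z = mu.paths"
    unfolding Z_def using distr_driving_sequence[OF assms(1,4) \<mu>_def mu.prob_space_axioms] by auto
  have mat_Z: "mat_prod As n \<omega> = product n (Z \<omega>)" for n \<omega>
    unfolding Z_def by (rule mat_prod_driving_sequence)
  have integral_Z: "(\<integral>\<^sup>+\<omega>. u (Z \<omega>) \<partial>M) = (\<integral>\<^sup>+\<omega>. u \<omega> \<partial>mu.paths)"
    if [measurable]: "u \<in> borel_measurable mu.paths" for u
    using nn_integral_distr[OF Z, of u] by (simp add: distr_Z)

  have moment: "norm_moment M (mat_prod As n) s = mu.mom s n" for n s
    unfolding norm_moment_def mu.mom_def mat_Z by (rule integral_Z) measurable
  have moment_A: "norm_moment M A s = mu.mom s 1" for s
  proof -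
    have "norm_moment M A s = (\<integral>\<^sup>+p. ennreal (opnorm (fst p) powr s) \<partial>distr M \<mu> (\<lambda>\<omega>. (A \<omega>, B \<omega>)))"
      unfolding norm_moment_def by (subst nn_integral_distr) auto
    thus ?thesis unfolding distr_AB mu.mom_1 .
  qed
  have "expectation_ext M (\<lambda>\<omega>. log_ext (ennreal (opnorm (mat_prod As n \<omega>))))
      = expectation_ext mu.paths (\<lambda>\<omega>. log_ext (ennreal (opnorm (product n \<omega>))))" for n
    unfolding expectation_ext_def mat_Z
    by (simp add: e2ennreal_log_ext e2ennreal_uminus_log_ext opnorm_nonneg
        integral_Z[of "\<lambda>\<omega>. log_pos (opnorm (product n \<omega>))"] integral_Z[of "\<lambda>\<omega>. log_neg (opnorm (product n \<omega>))"])
  hence lyap: "lyapunov_exponent mu.paths coord_A < 0"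
    using a by (simp add: lyapunov_exponent_def)
  have h_moment: "h_moment mu.paths coord_A \<alpha> = 1"
    using e(5) by (simp add: h_moment_def moment mu.mom_def)

  \<comment> \<open>A real exponent strictly inside the gap leaves room for exponents s above alpha
    with summable overshoot layers.\<close>
  obtain \<beta> where \<beta>: "ereal \<alpha> < ereal \<beta>" "ereal \<beta> < \<alpha>\<^sub>p" using ereal_dense2[OF g(4)] by blast
  have "ereal \<beta> < moment_index M A" using \<beta>(2) g(5) by (rule less_le_trans)
  \<comment> \<open>The supremum only provides a finite moment at some t above beta; interpolation
    with exponent 0 brings it down to beta.\<close>
  then obtain t where t: "\<beta> < t" "norm_moment M A t < \<infinity>"
    unfolding moment_index_def less_Sup_iff by auto
  have \<beta>_mom: "mu.mom \<beta> 1 < \<infinity>"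
    by (rule mu.mom_1_finite_mono[of \<beta> t]) (use t \<beta> e(3) in \<open>auto simp: moment_A\<close>)

  have \<nu>: "prob_space \<nu>" "sets \<nu> = sets borel"
    and stat: "distr (\<nu> \<Otimes>\<^sub>M M) borel (\<lambda>(x, \<omega>). A \<omega> *v x + B \<omega>) = \<nu>"
    using f(1) by (auto simp: stationary_distribution_def)
  note [measurable_cong] = \<nu>(2)
  have "distr (\<nu> \<Otimes>\<^sub>M \<mu>) borel (\<lambda>(x, p). fst p *v x + snd p) = \<nu>"
  proof -
    have "\<nu> \<Otimes>\<^sub>M \<mu> = distr \<nu> \<nu> (\<lambda>x. x) \<Otimes>\<^sub>M distr M \<mu> (\<lambda>\<omega>. (A \<omega>, B \<omega>))"
      by (simp add: distr_AB)
    also have "\<dots> = distr (\<nu> \<Otimes>\<^sub>M M) (\<nu> \<Otimes>\<^sub>M \<mu>) (\<lambda>(x, \<omega>). (x, A \<omega>, B \<omega>))"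
      by (rule pair_measure_distr) (auto simp: distr_AB intro: mu.sigma_finite_measure_axioms)
    finally have "distr (\<nu> \<Otimes>\<^sub>M \<mu>) borel (\<lambda>(x, p). fst p *v x + snd p)
        = distr (distr (\<nu> \<Otimes>\<^sub>M M) (\<nu> \<Otimes>\<^sub>M \<mu>) (\<lambda>(x, \<omega>). (x, A \<omega>, B \<omega>))) borel (\<lambda>(x, p). fst p *v x + snd p)"
      by simp
    also have "\<dots> = distr (\<nu> \<Otimes>\<^sub>M M) borel ((\<lambda>(x, p). fst p *v x + snd p) \<circ> (\<lambda>(x, \<omega>). (x, A \<omega>, B \<omega>)))"
      by (rule distr_distr) (auto simp: split_beta')
    also have "\<dots> = \<nu>" using stat by (simp add: o_def split_beta')
    finally show ?thesis .
  qed
  note \<nu>_stat = \<nu> this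

  have tail_\<mu>: "measure \<mu> {p\<in>space \<mu>. r < norm (fst p *v x + snd p)}
      = measure M {\<omega>\<in>space M. r < norm (A \<omega> *v x + B \<omega>)}" for r x
  proof -
    have "measure \<mu> {p\<in>space \<mu>. r < norm (fst p *v x + snd p)}
        = measure (distr M \<mu> (\<lambda>\<omega>. (A \<omega>, B \<omega>))) {p\<in>space \<mu>. r < norm (fst p *v x + snd p)}"
      by (simp add: distr_AB)
    also have "\<dots> = measure M ((\<lambda>\<omega>. (A \<omega>, B \<omega>)) -` {p\<in>space \<mu>. r < norm (fst p *v x + snd p)} \<inter> space M)"
      by (rule measure_distr) auto
    also have "(\<lambda>\<omega>. (A \<omega>, B \<omega>)) -` {p\<in>space \<mu>. r < norm (fst p *v x + snd p)} \<inter> space M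
        = {\<omega>\<in>space M. r < norm (A \<omega> *v x + B \<omega>)}"
      using measurable_space[OF AB'] by auto
    finally show ?thesis .
  qed
  have tail: "measure \<mu> {p\<in>space \<mu>. z * R < norm (fst p *v x + snd p)}
      \<le> C\<^sub>0 * z powr (- \<beta>) * measure \<mu> {p\<in>space \<mu>. R < norm (fst p *v x + snd p)}"
    if "R\<^sub>0 \<le> R" "z\<^sub>0 \<le> z" "norm x \<le> R" for R z x
    unfolding tail_\<mu>
    by (rule tail_bound_real[of _ _ _ \<alpha>\<^sub>p]) (use that g \<beta> in auto)

  have nondeg: "measure mu.paths {\<omega>\<in>space mu.paths. x \<bullet> (product n\<^sub>0 \<omega> *v y) = 0} < 1"
    if "x \<noteq> 0" "y \<noteq> 0" for x y
  proof -
    have "measure mu.paths {\<omega>\<in>space mu.paths. x \<bullet> (product n\<^sub>0 \<omega> *v y) = 0}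
        = measure (distr M mu.paths Z) {\<omega>\<in>space mu.paths. x \<bullet> (product n\<^sub>0 \<omega> *v y) = 0}"
      by (simp add: distr_Z)
    also have "\<dots> = measure M (Z -` {\<omega>\<in>space mu.paths. x \<bullet> (product n\<^sub>0 \<omega> *v y) = 0} \<inter> space M)"
      by (rule measure_distr) auto
    also have "Z -` {\<omega>\<in>space mu.paths. x \<bullet> (product n\<^sub>0 \<omega> *v y) = 0} \<inter> space M
        = {\<omega>\<in>space M. x \<bullet> (mat_prod As n\<^sub>0 \<omega> *v y) = 0}"
      using measurable_space[OF Z] by (auto simp: mat_Z)
    also have "measure M \<dots> < 1" using h(2) that by blast
    finally show ?thesis .
  qed

  have "(\<integral>\<^sup>+\<omega>. ennreal_of_enat (exit_time As Bs R x\<^sub>0 \<omega>) \<partial>M) = mu.mean_exit R x\<^sub>0" for R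
  proof -
    have "exit_time As Bs R x\<^sub>0 \<omega> = exit_time coord_A coord_B R x\<^sub>0 (Z \<omega>)" for \<omega>
      unfolding exit_time_def Z_def by (subst affine_process_driving_sequence) (rule refl)
    thus ?thesis unfolding mu.mean_exit_def
      by (simp add: integral_Z[of "\<lambda>\<omega>. ennreal_of_enat (exit_time coord_A coord_B R x\<^sub>0 \<omega>)"] mu.measurable_exit_time)
  qed
  moreover have "((\<lambda>R. log_ext (mu.mean_exit R x\<^sub>0) / ereal (ln R)) \<longlongrightarrow> ereal \<alpha>) at_top"
    by (rule mu.mean_exit_log_limit[OF lyap e(3) h_moment _ \<beta>_mom \<nu>_stat
          measure_tail_pos_of_unbounded_support[OF \<nu> f(2)] g(1,2) tail h(1) nondeg])
       (use \<beta> in auto)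
  ultimately show "((\<lambda>R. log_ext (\<integral>\<^sup>+\<omega>. ennreal_of_enat (exit_time As Bs R x\<^sub>0 \<omega>) \<partial>M) / ereal (ln R))
      \<longlongrightarrow> ereal \<alpha>) at_top"
    by simp
qed

end
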